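(* Let $\mathcal G\in\mathbf G$ be a metric graph with at least one half-line, with edge set $\mathcal E$ and vertex set $\mathcal V$, and let $p>2$. Let $W\in L^\infty(\mathcal G)$ and $\rho\in L^\infty(\mathcal G)\setminus\{0\}$ be such that there exists $a>0$ for which, for every $e\in\mathcal E$, either $\rho\ge a$ on $e$ or $\rho\equiv0$ on $e$. If $(\lambda,u)\in\mathbb R\times H^1(\mathcal G)$ is a finite Morse index solution of $$\begin{cases}-u''+W(x)u+\lambda u=\rho(x)|u|^{p-2}u&\text{on every edge } e\in\mathcal E,\\ u\text{ is continuous on }\mathcal G,\\ \sum_{e\succ v}\frac{du_e}{dx}(v)=0&\text{at every vertex }v\in\mathcal V,\end{cases}$$ then $$\lambda\ge-\inf_{h\text{ half-line}}\ \limsup_{x\to+\infty,\ x\in h}W(x),$$ where the infimum is over the half-lines $h$ of $\mathcal G$, each identified with $[0,+\infty)$.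
   Context: Metric graphs: $\mathcal G=(\mathcal E,\mathcal V)$ with edges $\mathcal E$ and vertices $\mathcal V$; each bounded edge $e$ is identified with $[0,\ell_e]$ and each unbounded edge (half-line) with $[0,+\infty)$. $\mathbf G$ is the class of metric graphs that are connected, have at most countably many edges, all of whose vertices are adjacent to finitely many edges, and for which the infimum of the lengths of all edges is positive. $u_e$ is the restriction of $u$ to $e$. $H^1(\mathcal G)$ is the space of continuous $u:\mathcal G\to\mathbb R$ with $u_e\in H^1(e)$ for every edge and $\sum_e(\|u_e'\|_{L^2(e)}^2+\|u_e\|_{L^2(e)}^2)<\infty$. $C_c(\mathcal G)$ is the space of continuous functions with compact support. The notation $e\succ v$ means that $e$ is incident to $v$, and $\frac{du_e}{dx}(v)$ is the derivative along $e$ at $v$ directed away from $v$. Solutions are weak solutions: $\int_{\mathcal G}(u'\varphi'+(W+\lambda)u\varphi)\,dx=\int_{\mathcal G}\rho|u|^{p-2}u\varphi\,dx$ for all $\varphi\in H^1(\mathcal G)\cap C_c(\mathcal G)$. The limit superior of $W$ is the essential one. The Morse index of a solution $(\lambda,u)$ is the maximal dimension (or $+\infty$ if there is no maximal integer) of a subspace $X\subset H^1(\mathcal G)\cap C_c(\mathcal G)$ such that $\int_{\mathcal G}(|\varphi'|^2+(W+\lambda)\varphi^2-(p-1)\rho|u|^{p-2}\varphi^2)\,dx<0$ for all $\varphi\in X\setminus\{0\}$. *)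

theory Defs
  imports "HOL-Probability.Probability" "HOL-Library.Function_Algebras"
    "HOL-Library.Extended_Nat"
begin

section \<open>Metric graphs\<close>

text \<open>Loops and multiple edges are allowed. An edge e is a copy of [0, len e], or of
  [0, +oo) if len e is infinite; the parameter 0 corresponds to the vertex src e, the parameter
  len e to the vertex tgt e. The value of tgt on a half-line is never used.\<close>

record ('v, 'e) metric_graph =
  verts :: "'v set"
  edges :: "'e set"
  len :: "'e \<Rightarrow> ereal"
  src :: "'e \<Rightarrow> 'v"
  tgt :: "'e \<Rightarrow> 'v"

definition wf_metric_graph :: "('v, 'e) metric_graph \<Rightarrow> bool" where
  "wf_metric_graph G \<longleftrightarrow>
     (\<forall>e\<in>edges G. 0 < len G e \<and> src G e \<in> verts G \<and> (len G e < \<infinity> \<longrightarrow> tgt G e \<in> verts G))"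

definition half_lines :: "('v, 'e) metric_graph \<Rightarrow> 'e set" where
  "half_lines G = {e \<in> edges G. len G e = \<infinity>}"

definition incident :: "('v, 'e) metric_graph \<Rightarrow> 'e \<Rightarrow> 'v \<Rightarrow> bool" where
  "incident G e v \<longleftrightarrow> src G e = v \<or> (len G e < \<infinity> \<and> tgt G e = v)"

definition edge_interval :: "('v, 'e) metric_graph \<Rightarrow> 'e \<Rightarrow> real set" where
  "edge_interval G e = {x. 0 \<le> x \<and> ereal x \<le> len G e}"

text \<open>The points of the graph: the disjoint union of the edges with the endpoints glued
  at the vertices.\<close>

datatype ('v, 'e) gpoint = Vertex 'v | Inner 'e real

definition points :: "('v, 'e) metric_graph \<Rightarrow> ('v, 'e) gpoint set" where
  "points G = Vertex ` verts G \<union> {Inner e x |e x. e \<in> edges G \<and> 0 < x \<and> ereal x < len G e}"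

definition edge_pt :: "('v, 'e) metric_graph \<Rightarrow> 'e \<Rightarrow> real \<Rightarrow> ('v, 'e) gpoint" where
  "edge_pt G e x =
     (if x = 0 then Vertex (src G e)
      else if ereal x = len G e then Vertex (tgt G e)
      else Inner e x)"

text \<open>The gluing (quotient) topology. It is the topology of the path metric when every vertex
  has finite degree and the edge lengths are bounded away from 0.\<close>

definition graph_topology :: "('v, 'e) metric_graph \<Rightarrow> ('v, 'e) gpoint topology" where
  "graph_topology G = topology (\<lambda>U. U \<subseteq> points G \<and>
     (\<forall>e\<in>edges G. openin (top_of_set (edge_interval G e)) {x \<in> edge_interval G e. edge_pt G e x \<in> U}))"

lemma openin_graph_topology:
  "openin (graph_topology G) U \<longleftrightarrow> U \<subseteq> points G \<and>
     (\<forall>e\<in>edges G. openin (top_of_set (edge_interval G e)) {x \<in> edge_interval G e. edge_pt G e x \<in> U})"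
proof -
  let ?S = "\<lambda>e U. {x \<in> edge_interval G e. edge_pt G e x \<in> U}"
  have int: "?S e (U \<inter> V) = ?S e U \<inter> ?S e V" for e U V by auto
  have un: "?S e (\<Union>K) = \<Union>(?S e ` K)" for e K by auto
  have "istopology (\<lambda>U. U \<subseteq> points G \<and>
      (\<forall>e\<in>edges G. openin (top_of_set (edge_interval G e)) (?S e U)))"
    unfolding istopology_def
  proof (rule conjI; intro allI impI)
    fix U V
    assume "U \<subseteq> points G \<and> (\<forall>e\<in>edges G. openin (top_of_set (edge_interval G e)) (?S e U))"
      and "V \<subseteq> points G \<and> (\<forall>e\<in>edges G. openin (top_of_set (edge_interval G e)) (?S e V))"
    then show "U \<inter> V \<subseteq> points G \<and>
        (\<forall>e\<in>edges G. openin (top_of_set (edge_interval G e)) (?S e (U \<inter> V)))"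
      unfolding int by (meson inf.coboundedI1 openin_Int)
  next
    fix K
    assume *: "\<forall>U\<in>K. U \<subseteq> points G \<and>
        (\<forall>e\<in>edges G. openin (top_of_set (edge_interval G e)) (?S e U))"
    show "\<Union>K \<subseteq> points G \<and>
        (\<forall>e\<in>edges G. openin (top_of_set (edge_interval G e)) (?S e (\<Union>K)))"
    proof (intro conjI ballI)
      show "\<Union>K \<subseteq> points G" using * by blast
      fix e assume "e \<in> edges G"
      then show "openin (top_of_set (edge_interval G e)) (?S e (\<Union>K))"
        unfolding un using * by (intro openin_Union) auto
    qed
  qed
  then show ?thesis
    unfolding graph_topology_def by (simp add: topology_inverse')
qed

text \<open>The class \<open>\<^bold>G\<close>.\<close>

definition graph_class :: "('v, 'e) metric_graph \<Rightarrow> bool" where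
  "graph_class G \<longleftrightarrow> wf_metric_graph G \<and>
     connected_space (graph_topology G) \<and>
     countable (edges G) \<and>
     (\<forall>v\<in>verts G. finite {e \<in> edges G. incident G e v}) \<and>
     0 < (INF e\<in>edges G. len G e)"


section \<open>Sobolev spaces\<close>

text \<open>Functions on an interval or on the graph are honest functions; membership in Lebesgue
  and Sobolev spaces is that of the class modulo null sets.\<close>

definition L2_on :: "real set \<Rightarrow> (real \<Rightarrow> real) \<Rightarrow> bool" where
  "L2_on I f \<longleftrightarrow> f \<in> borel_measurable (lebesgue_on I) \<and> integrable (lebesgue_on I) (\<lambda>x. (f x)\<^sup>2)"

text \<open>Test functions: class \<open>C\<^sup>1\<close> with compact support inside the given open set.\<close>

definition C1_compact :: "real set \<Rightarrow> (real \<Rightarrow> real) \<Rightarrow> bool" where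
  "C1_compact S \<phi> \<longleftrightarrow> \<phi> C1_differentiable_on UNIV \<and>
     compact (closure {x. \<phi> x \<noteq> 0}) \<and> closure {x. \<phi> x \<noteq> 0} \<subseteq> S"

definition weak_derivative :: "real set \<Rightarrow> (real \<Rightarrow> real) \<Rightarrow> (real \<Rightarrow> real) \<Rightarrow> bool" where
  "weak_derivative I f g \<longleftrightarrow> L2_on I g \<and>
     (\<forall>\<phi>. C1_compact (interior I) \<phi> \<longrightarrow>
        (LINT x|lebesgue_on I. f x * deriv \<phi> x) = - (LINT x|lebesgue_on I. g x * \<phi> x))"

definition H1_on :: "real set \<Rightarrow> (real \<Rightarrow> real) \<Rightarrow> bool" where
  "H1_on I f \<longleftrightarrow> L2_on I f \<and> (\<exists>g. weak_derivative I f g)"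

text \<open>A representative of the weak derivative, which is unique up to null sets.\<close>

definition wderiv :: "real set \<Rightarrow> (real \<Rightarrow> real) \<Rightarrow> real \<Rightarrow> real" where
  "wderiv I f = (SOME g. weak_derivative I f g)"

definition on_edge ::
  "('v, 'e) metric_graph \<Rightarrow> (('v, 'e) gpoint \<Rightarrow> real) \<Rightarrow> 'e \<Rightarrow> real \<Rightarrow> real" where
  "on_edge G u e x = u (edge_pt G e x)"

definition edge_deriv ::
  "('v, 'e) metric_graph \<Rightarrow> (('v, 'e) gpoint \<Rightarrow> real) \<Rightarrow> 'e \<Rightarrow> real \<Rightarrow> real" where
  "edge_deriv G u e = wderiv (edge_interval G e) (on_edge G u e)"

abbreviation edge_measure :: "('v, 'e) metric_graph \<Rightarrow> 'e \<Rightarrow> real measure" where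
  "edge_measure G e \<equiv> lebesgue_on (edge_interval G e)"

definition graph_integral :: "('v, 'e) metric_graph \<Rightarrow> ('e \<Rightarrow> real \<Rightarrow> real) \<Rightarrow> real" where
  "graph_integral G f = (\<Sum>\<^sub>\<infinity>e\<in>edges G. LINT x|edge_measure G e. f e x)"

text \<open>Functions on the graph are normalised to vanish outside its set of points, so that
  equality of functions is equality on the graph.\<close>

definition H1_graph :: "('v, 'e) metric_graph \<Rightarrow> (('v, 'e) gpoint \<Rightarrow> real) set" where
  "H1_graph G = {u. (\<forall>q. q \<notin> points G \<longrightarrow> u q = 0) \<and>
     continuous_map (graph_topology G) euclideanreal u \<and>
     (\<forall>e\<in>edges G. H1_on (edge_interval G e) (on_edge G u e)) \<and>
     (\<lambda>e. (LINT x|edge_measure G e. (edge_deriv G u e x)\<^sup>2) +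
          (LINT x|edge_measure G e. (on_edge G u e x)\<^sup>2)) summable_on edges G}"

definition Cc_graph :: "('v, 'e) metric_graph \<Rightarrow> (('v, 'e) gpoint \<Rightarrow> real) set" where
  "Cc_graph G = {u. (\<forall>q. q \<notin> points G \<longrightarrow> u q = 0) \<and>
     continuous_map (graph_topology G) euclideanreal u \<and>
     compactin (graph_topology G) (graph_topology G closure_of {q \<in> points G. u q \<noteq> 0})}"

definition Linf_graph :: "('v, 'e) metric_graph \<Rightarrow> (('v, 'e) gpoint \<Rightarrow> real) \<Rightarrow> bool" where
  "Linf_graph G f \<longleftrightarrow>
     (\<forall>e\<in>edges G. on_edge G f e \<in> borel_measurable (edge_measure G e)) \<and>
     (\<exists>C. \<forall>e\<in>edges G. AE x in edge_measure G e. \<bar>on_edge G f e x\<bar> \<le> C)"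

definition ae_zero_graph :: "('v, 'e) metric_graph \<Rightarrow> (('v, 'e) gpoint \<Rightarrow> real) \<Rightarrow> bool" where
  "ae_zero_graph G f \<longleftrightarrow> (\<forall>e\<in>edges G. AE x in edge_measure G e. on_edge G f e x = 0)"


section \<open>Solutions and Morse index\<close>

text \<open>Testing against continuous functions encodes both the differential equation on the edges and
  the Kirchhoff condition at the vertices.\<close>

definition weak_solution ::
  "('v, 'e) metric_graph \<Rightarrow> real \<Rightarrow> (('v, 'e) gpoint \<Rightarrow> real) \<Rightarrow> (('v, 'e) gpoint \<Rightarrow> real) \<Rightarrow>
   real \<Rightarrow> (('v, 'e) gpoint \<Rightarrow> real) \<Rightarrow> bool" where
  "weak_solution G p W \<rho> lam u \<longleftrightarrow> u \<in> H1_graph G \<and>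
     (\<forall>\<phi> \<in> H1_graph G \<inter> Cc_graph G.
        graph_integral G (\<lambda>e x. edge_deriv G u e x * edge_deriv G \<phi> e x
            + (on_edge G W e x + lam) * on_edge G u e x * on_edge G \<phi> e x)
      = graph_integral G (\<lambda>e x. on_edge G \<rho> e x * \<bar>on_edge G u e x\<bar> powr (p - 2)
            * on_edge G u e x * on_edge G \<phi> e x))"

definition morse_form ::
  "('v, 'e) metric_graph \<Rightarrow> real \<Rightarrow> (('v, 'e) gpoint \<Rightarrow> real) \<Rightarrow> (('v, 'e) gpoint \<Rightarrow> real) \<Rightarrow>
   real \<Rightarrow> (('v, 'e) gpoint \<Rightarrow> real) \<Rightarrow> (('v, 'e) gpoint \<Rightarrow> real) \<Rightarrow> real" where
  "morse_form G p W \<rho> lam u \<phi> = graph_integral G (\<lambda>e x. (edge_deriv G \<phi> e x)\<^sup>2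
      + (on_edge G W e x + lam) * (on_edge G \<phi> e x)\<^sup>2
      - (p - 1) * on_edge G \<rho> e x * \<bar>on_edge G u e x\<bar> powr (p - 2) * (on_edge G \<phi> e x)\<^sup>2)"

interpretation fun_vs: vector_space "\<lambda>(c::real) (f::'a \<Rightarrow> real) x. c * f x"
  by unfold_locales (auto simp: fun_eq_iff algebra_simps)

text \<open>The library's \<open>dim\<close> is meaningful only for spaces of finite dimension.\<close>

definition fun_edim :: "('a \<Rightarrow> real) set \<Rightarrow> enat" where
  "fun_edim X = (if \<exists>B. finite B \<and> fun_vs.span B = X then enat (fun_vs.dim X) else \<infinity>)"

definition morse_index ::
  "('v, 'e) metric_graph \<Rightarrow> real \<Rightarrow> (('v, 'e) gpoint \<Rightarrow> real) \<Rightarrow> (('v, 'e) gpoint \<Rightarrow> real) \<Rightarrow>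
   real \<Rightarrow> (('v, 'e) gpoint \<Rightarrow> real) \<Rightarrow> enat" where
  "morse_index G p W \<rho> lam u =
     (SUP X \<in> {X. fun_vs.subspace X \<and> X \<subseteq> H1_graph G \<inter> Cc_graph G \<and>
                  (\<forall>\<phi>\<in>X - {0}. morse_form G p W \<rho> lam u \<phi> < 0)}. fun_edim X)"

text \<open>The essential limit superior at \<open>+\<infinity>\<close>.\<close>

definition ess_limsup_at_top :: "(real \<Rightarrow> real) \<Rightarrow> ereal" where
  "ess_limsup_at_top f = (INF R\<in>{0..}. esssup (lebesgue_on {R..}) (\<lambda>x. ereal (f x)))"

end

theory Submission
  imports Defs
begin

text \<open>If \<open>lam\<close> were smaller, there would be a half-line \<open>h\<close>, a radius \<open>R\<close> and \<open>d > 0\<close> with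
  \<open>W + lam \<le> - d\<close> almost everywhere on \<open>h\<close> beyond \<open>R\<close>. Since \<open>\<rho> \<ge> 0\<close> on \<open>h\<close>, the quadratic form of
  a test function supported there is at most \<open>\<integral>(|\<phi>'|\<^sup>2 - d \<phi>\<^sup>2)\<close>. For the bump
  \<open>x\<^sup>2 (T - x)\<^sup>2\<close> on a cell of length \<open>T\<close> one has \<open>\<integral>|\<phi>'|\<^sup>2 / \<integral>\<phi>\<^sup>2 = 12 / T\<^sup>2\<close>, which is less than \<open>d\<close>
  for large \<open>T\<close>. Infinitely many such bumps on disjoint cells span an infinite-dimensional
  space on which the form is negative. That the chosen representative of the weak derivative
  of a bump is its classical derivative rests on the fundamental lemma of the
  calculus of variations.\<close>

section \<open>Integrals of continuous functions with compact support\<close>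

lemma integrable_continuous_supported:
  fixes g :: "real \<Rightarrow> real"
  assumes "continuous_on UNIV g" and "\<And>x. x \<notin> {a..b} \<Longrightarrow> g x = 0" and "S \<in> sets lebesgue"
  shows "integrable (lebesgue_on S) g"
proof -
  have "set_integrable lebesgue {a..b} g"
    using assms(1) continuous_on_subset by (intro absolutely_integrable_continuous_real) blast
  moreover have "(\<lambda>x. indicator {a..b} x *\<^sub>R g x) = g"
    using assms(2) by (auto simp: indicator_def fun_eq_iff)
  ultimately have "integrable lebesgue g"
    by (simp add: set_integrable_def)
  then show ?thesis
    using assms(3) integrable_mult_indicator[of S lebesgue g] by (simp add: integrable_restrict_space)
qed

lemma integral_continuous_supported:
  fixes g :: "real \<Rightarrow> real"
  assumes "continuous_on UNIV g" and "\<And>x. x \<notin> {a..b} \<Longrightarrow> g x = 0"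
    and "S \<in> sets lebesgue" and "{a..b} \<subseteq> S"
  shows "integral\<^sup>L (lebesgue_on S) g = integral {a..b} g"
proof -
  have "integral\<^sup>L (lebesgue_on S) g = integral S g"
    using assms by (intro lebesgue_integral_eq_integral integrable_continuous_supported)
  also have "\<dots> = integral {a..b} g"
  proof -
    have "integral S (\<lambda>x. if x \<in> {a..b} then g x else 0) = integral {a..b} g"
      unfolding integral_def integrable_on_def has_integral_restrict[OF assms(4)] ..
    moreover have "(\<lambda>x. if x \<in> {a..b} then g x else 0) = g"
      using assms(2) by auto
    ultimately show ?thesis by simp
  qed
  finally show ?thesis .
qed

text \<open>By the fundamental theorem of calculus on \<open>{a..b}\<close>: support in the open
  interval makes both boundary values vanish. Applied to a product, this is integration by
  parts.\<close>

lemma integral_deriv_supported: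
  fixes g :: "real \<Rightarrow> real"
  assumes der: "\<And>x. (g has_real_derivative g' x) (at x)" and cont: "continuous_on UNIV g'"
    and supp: "\<And>x. x \<notin> {a<..<b} \<Longrightarrow> g x = 0" and supp': "\<And>x. x \<notin> {a..b} \<Longrightarrow> g' x = 0"
    and S: "S \<in> sets lebesgue" "{a..b} \<subseteq> S" and ab: "a \<le> b"
  shows "integral\<^sup>L (lebesgue_on S) g' = 0"
proof -
  have "(g' has_integral (g b - g a)) {a..b}"
    using der ab by (intro fundamental_theorem_of_calculus)
      (auto simp: has_real_derivative_iff_has_vector_derivative intro: has_vector_derivative_at_within)
  then have "integral {a..b} g' = 0"
    using supp[of a] supp[of b] by (simp add: integral_unique)
  then show ?thesis
    using integral_continuous_supported[OF cont supp' S] by simp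
qed

section \<open>The fundamental lemma of the calculus of variations\<close>

text \<open>The Borel sets over which \<open>k\<close> integrates to 0 include the intervals and are
  closed under complements and countable disjoint unions, so they are all the Borel sets. Lebesgue
  sets differ from Borel sets by null sets, and a density is determined almost everywhere by its set
  integrals.\<close>

lemma AE_zero_of_interval_integrals:
  fixes k :: "real \<Rightarrow> real"
  assumes k: "integrable lebesgue k"
    and zero: "\<And>a b. a \<le> b \<Longrightarrow> (LINT x:{a..b}|lebesgue. k x) = 0"
  shows "AE x in lebesgue. k x = 0"
proof -
  have si: "set_integrable lebesgue A k" if "A \<in> sets lebesgue" for A
    using integrable_mult_indicator[OF that k] by (simp add: set_integrable_def)
  \<comment> \<open>The complement case of the Borel induction needs the total integral, obtained by
    exhausting the line with the intervals \<open>{- real n..real n}\<close>.\<close>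
  have UNIV0: "integral\<^sup>L lebesgue k = 0"
  proof -
    have "(\<lambda>n. LINT x:{- real n..real n}|lebesgue. k x) \<longlonglongrightarrow> (LINT x:(\<Union>n. {- real n..real n})|lebesgue. k x)"
      by (intro set_integral_cont_up si) (auto simp: incseq_def)
    moreover have "(\<Union>n. {- real n..real n}) = UNIV"
    proof -
      have "\<exists>n. - real n \<le> x \<and> x \<le> real n" for x :: real
        using real_arch_simple[of "\<bar>x\<bar>"] by (metis abs_le_iff minus_le_iff)
      then show ?thesis by auto
    qed
    ultimately have "(LINT x:UNIV|lebesgue. k x) = 0"
      using zero LIMSEQ_unique[OF _ tendsto_const] by (simp add: LIMSEQ_const_iff)
    then show ?thesis by (simp add: set_lebesgue_integral_def)
  qed
  have borel0: "(LINT x:A|lebesgue. k x) = 0" if "A \<in> sets borel" for A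
    using that
  proof (induction rule: borel_set_induct)
    case empty then show ?case by (simp add: set_lebesgue_integral_def)
  next
    case (interval a b) then show ?case by (rule zero)
  next
    case (compl A)
    then have A: "A \<in> sets lebesgue" "- A \<in> sets lebesgue"
      using borel_comp[of A] by auto
    have "(LINT x:A \<union> (- A)|lebesgue. k x) = (LINT x:A|lebesgue. k x) + (LINT x:-A|lebesgue. k x)"
      using A by (intro set_integral_Un si) auto
    then show ?case
      using compl UNIV0 by (simp add: set_lebesgue_integral_def Compl_eq_Diff_UNIV)
  next
    case (union f)
    then have "range f \<subseteq> sets lebesgue" by auto
    then have "(LINT x:(\<Union>i. f i)|lebesgue. k x) = (\<Sum>i. LINT x:f i|lebesgue. k x)"
      using union.hyps by (intro lebesgue_integral_countable_add si)
        (auto simp: disjoint_family_on_def)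
    then show ?case using union.IH by simp
  qed
  have "(LINT x:A|lebesgue. k x) = (LINT x:A|lebesgue. 0)" if "A \<in> sets lebesgue" for A
  proof -
    from that obtain S N N' where A: "A = S \<union> N" and N: "N \<subseteq> N'" "N' \<in> null_sets lborel" "S \<in> sets lborel"
      by (rule sets_completionE)
    have S: "S \<in> sets lebesgue" using N by simp
    have "AE x in lborel. x \<notin> N'" using N(2) by (rule AE_not_in)
    then have "AE x in lebesgue. x \<notin> N'" by (rule AE_completion)
    then have "(LINT x:A|lebesgue. k x) = (LINT x:S|lebesgue. k x)"
      unfolding set_lebesgue_integral_def
      by (intro integral_cong_AE borel_measurable_integrable integrable_mult_indicator k that S)
        (use N A in \<open>auto simp: indicator_def elim!: eventually_mono\<close>)
    also have "\<dots> = 0" using borel0[of S] N by simp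
    finally show ?thesis by simp
  qed
  then show ?thesis
    by (intro density_unique_real k) auto
qed

section \<open>C1 bumps and C1 test functions\<close>

lemma has_real_derivative_max_power2:
  "((\<lambda>x. (max 0 x)\<^sup>2) has_real_derivative 2 * max 0 x) (at (x::real))"
proof (cases x "0 :: real" rule: linorder_cases)
  case less
  have "((\<lambda>x. 0) has_real_derivative 2 * max 0 x) (at x)" using less by simp
  then show ?thesis
    by (rule has_field_derivative_transform_within_open[of _ _ _ "{..<0}"]) (use less in auto)
next
  case greater
  have "((\<lambda>x. x\<^sup>2) has_real_derivative 2 * max 0 x) (at x)"
    using greater by (auto intro!: derivative_eq_intros)
  then show ?thesis
    by (rule has_field_derivative_transform_within_open[of _ _ _ "{0<..}"]) (use greater in auto)
next
  case equal
  \<comment> \<open>The square smooths the corner of the truncation: the difference quotient at 0 is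
    at most \<open>|h|\<close> in absolute value.\<close>
  have "((\<lambda>h::real. (max 0 h)\<^sup>2 / h) \<longlongrightarrow> 0) (at 0)"
  proof (rule Lim_null_comparison)
    show "\<forall>\<^sub>F h::real in at 0. norm ((max 0 h)\<^sup>2 / h) \<le> \<bar>h\<bar>"
      by (intro always_eventually) (auto simp: max_def power2_eq_square)
    show "((\<lambda>h::real. \<bar>h\<bar>) \<longlongrightarrow> 0) (at 0)" by (rule tendsto_eq_intros refl | simp)+
  qed
  then show ?thesis using equal by (simp add: DERIV_def)
qed

text \<open>Truncated squares instead of a case distinction: the double zeros at both ends make the
  extension by zero C1, and the product rule gives its derivative on the whole line at once.\<close>

definition bump :: "real \<Rightarrow> real \<Rightarrow> real \<Rightarrow> real" where
  "bump a b x = (max 0 (x - a))\<^sup>2 * (max 0 (b - x))\<^sup>2"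

definition bump' :: "real \<Rightarrow> real \<Rightarrow> real \<Rightarrow> real" where
  "bump' a b x = 2 * max 0 (x - a) * (max 0 (b - x))\<^sup>2 - 2 * (max 0 (x - a))\<^sup>2 * max 0 (b - x)"

lemma bump_has_derivative: "(bump a b has_real_derivative bump' a b x) (at x)"
proof -
  have 1: "((\<lambda>x. (max 0 (x - a))\<^sup>2) has_real_derivative 2 * max 0 (x - a) * 1) (at x)"
    by (rule DERIV_chain2[OF has_real_derivative_max_power2]) (auto intro!: derivative_eq_intros)
  have 2: "((\<lambda>x. (max 0 (b - x))\<^sup>2) has_real_derivative 2 * max 0 (b - x) * (-1)) (at x)"
    by (rule DERIV_chain2[OF has_real_derivative_max_power2]) (auto intro!: derivative_eq_intros)
  show ?thesis
    unfolding bump_def[abs_def] bump'_def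
    by (rule DERIV_cong[OF DERIV_mult[OF 1 2]]) (simp add: algebra_simps)
qed

lemma continuous_bump': "continuous_on UNIV (bump' a b)"
  unfolding bump'_def[abs_def] by (intro continuous_intros)

lemma bump_eq_0_iff: "bump a b x = 0 \<longleftrightarrow> x \<notin> {a<..<b}"
  by (auto simp: bump_def max_def)

lemma bump'_eq_0: "x \<notin> {a<..<b} \<Longrightarrow> bump' a b x = 0"
  by (auto simp: bump'_def max_def)

lemma C1_compactI:
  assumes der: "\<And>x. (f has_real_derivative f' x) (at x)" and cont: "continuous_on UNIV f'"
    and supp: "\<And>x. x \<notin> {a..b} \<Longrightarrow> f x = 0" and sub: "{a..b} \<subseteq> S"
  shows "C1_compact S f"
proof -
  have "closure {x. f x \<noteq> 0} \<subseteq> {a..b}"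
    using supp by (intro closure_minimal) (blast, simp)
  moreover from this have "compact (closure {x. f x \<noteq> 0})"
    by (metis bounded_closed_interval bounded_subset closed_closure compact_eq_bounded_closed)
  moreover have "f C1_differentiable_on UNIV"
    using der cont unfolding C1_differentiable_on_def
    by (auto simp: has_real_derivative_iff_has_vector_derivative)
  ultimately show ?thesis using sub by (auto simp: C1_compact_def)
qed

lemma C1_compactE:
  assumes "C1_compact S f"
  obtains a b where "\<And>x. (f has_real_derivative deriv f x) (at x)" "continuous_on UNIV (deriv f)"
    "\<And>x. x \<notin> {a<..<b} \<Longrightarrow> f x = 0" "\<And>x. x \<notin> {a<..<b} \<Longrightarrow> deriv f x = 0" "a \<le> b"
proof -
  from assms obtain D where D: "\<And>x. (f has_real_derivative D x) (at x)" "continuous_on UNIV D"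
    by (auto simp: C1_compact_def C1_differentiable_on_def has_real_derivative_iff_has_vector_derivative)
  have d: "deriv f = D" using D(1) DERIV_imp_deriv by blast
  from assms have "bounded {x. f x \<noteq> 0}"
    unfolding C1_compact_def by (meson bounded_subset closure_subset compact_imp_bounded)
  then obtain C where "\<And>x. f x \<noteq> 0 \<Longrightarrow> \<bar>x\<bar> \<le> C"
    by (auto simp: bounded_iff)
  then have out: "f x = 0" if "\<bar>x\<bar> > C" for x using that by (metis not_le)
  \<comment> \<open>The margin 1 puts every \<open>x\<close> with \<open>|x| \<ge> c\<close> into
    the open set where \<open>|x|\<close> exceeds \<open>C\<close>, on which \<open>f\<close>
    vanishes identically; hence the derivative vanishes as well. The absolute value of
    \<open>C\<close> makes \<open>c\<close> positive, so that \<open>- c \<le> c\<close>.\<close>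
  define c where "c = \<bar>C\<bar> + 1"
  have "D x = 0" if "\<bar>x\<bar> \<ge> c" for x
  proof -
    have "((\<lambda>x. 0) has_real_derivative D x) (at x)"
      by (rule has_field_derivative_transform_within_open[OF D(1), of "{x. C < \<bar>x\<bar>}"])
        (use out that in \<open>auto simp: c_def intro!: open_Collect_less continuous_intros\<close>)
    then show ?thesis using DERIV_unique DERIV_const by blast
  qed
  then show ?thesis
    using D out by (intro that[of "-c" c]) (auto simp: d c_def)
qed

text \<open>Dominated convergence: the indicator function of the open interval is a pointwise limit
  of admissible test functions with values in \<open>[0, 1]\<close>, and the two endpoints form a
  null set.\<close>

lemma interval_integral_zero_of_C1_compact:
  fixes k :: "real \<Rightarrow> real"
  assumes int: "set_integrable lebesgue {a..b} k" and sub: "{a..b} \<subseteq> U" and ab: "a < b"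
    and test: "\<And>\<phi>. C1_compact U \<phi> \<Longrightarrow> (LINT x|lebesgue. k x * \<phi> x) = 0"
  shows "(LINT x:{a..b}|lebesgue. k x) = 0"
proof -
  \<comment> \<open>Each squared factor of the bump is at most \<open>(b - a)^2\<close> on the
    interval, so this scaling brings the values into \<open>[0, 1]\<close>.\<close>
  define \<beta> where "\<beta> x = bump a b x / (b - a) ^ 4" for x
  have \<beta>01: "0 \<le> \<beta> x \<and> \<beta> x \<le> 1" for x
  proof -
    have "bump a b x \<le> (b - a)\<^sup>2 * (b - a)\<^sup>2" if "a < x" "x < b"
      unfolding bump_def using that by (intro mult_mono power_mono) auto
    then show ?thesis
      using ab bump_eq_0_iff[of a b x]
      by (cases "x \<in> {a<..<b}") (auto simp: \<beta>_def bump_def power_add[symmetric])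
  qed
  have \<beta>0: "\<beta> x = 0 \<longleftrightarrow> x \<notin> {a<..<b}" for x
    using ab by (auto simp: \<beta>_def bump_eq_0_iff)
  \<comment> \<open>\<open>C\<^sup>1\<close> test functions increasing to the indicator function of \<open>{a<..<b}\<close>\<close>
  define \<phi> where "\<phi> n x = 1 - (1 - \<beta> x) ^ Suc n" for n x
  have C1: "C1_compact U (\<phi> n)" for n
  proof (rule C1_compactI[OF _ _ _ sub])
    fix x
    have "(\<beta> has_real_derivative bump' a b x / (b - a) ^ 4) (at x)"
      unfolding \<beta>_def by (intro DERIV_cdivide bump_has_derivative)
    then have "((\<lambda>x. 1 - \<beta> x) has_real_derivative 0 - bump' a b x / (b - a) ^ 4) (at x)"
      by (intro DERIV_diff DERIV_const)
    from DERIV_diff[OF DERIV_const[of 1] DERIV_power[OF this, of "Suc n"]]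
    show "(\<phi> n has_real_derivative real (Suc n) * (1 - \<beta> x) ^ n * (bump' a b x / (b - a) ^ 4)) (at x)"
      unfolding \<phi>_def by (rule DERIV_cong) simp
    show "\<phi> n x = 0" if "x \<notin> {a..b}"
    proof -
      have "x \<notin> {a<..<b}" using that by auto
      then have "\<beta> x = 0" using \<beta>0[of x] by blast
      then show ?thesis by (simp add: \<phi>_def)
    qed
  next
    have "continuous_on UNIV (bump a b)"
      using bump_has_derivative DERIV_continuous_on by blast
    then show "continuous_on UNIV (\<lambda>x. real (Suc n) * (1 - \<beta> x) ^ n * (bump' a b x / (b - a) ^ 4))"
      unfolding \<beta>_def using ab by (intro continuous_intros continuous_bump') auto
  qed
  have lim: "(\<lambda>n. \<phi> n x) \<longlonglongrightarrow> indicator {a<..<b} x" for x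
  proof (cases "x \<in> {a<..<b}")
    case True
    then have "(\<lambda>n. (1 - \<beta> x) ^ Suc n) \<longlonglongrightarrow> 0"
      using \<beta>01[of x] \<beta>0[of x] by (intro LIMSEQ_Suc LIMSEQ_realpow_zero) auto
    from tendsto_diff[OF tendsto_const[of 1] this] True show ?thesis by (simp add: \<phi>_def del: power_Suc)
  next
    case False
    then show ?thesis using \<beta>0[of x] by (simp add: \<phi>_def)
  qed
  have K: "integrable lebesgue (\<lambda>x. indicator {a..b} x * k x)"
    using int by (simp add: set_integrable_def)
  have meas: "\<phi> n \<in> borel_measurable lebesgue" for n
  proof -
    obtain a' b' where "\<And>x. (\<phi> n has_real_derivative deriv (\<phi> n) x) (at x)"
      using C1[of n] by (rule C1_compactE) blast
    then have "continuous_on UNIV (\<phi> n)" using DERIV_continuous_on by blast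
    then show ?thesis
      using continuous_imp_measurable_on_sets_lebesgue[of UNIV] by (simp add: lebesgue_on_UNIV_eq)
  qed
  have "(\<lambda>n. LINT x|lebesgue. indicator {a..b} x * k x * \<phi> n x) \<longlonglongrightarrow>
      (LINT x|lebesgue. indicator {a..b} x * k x * indicator {a<..<b} x)"
  proof (rule integral_dominated_convergence[where w = "\<lambda>x. norm (indicator {a..b} x * k x)"])
    have "0 \<le> (1 - \<beta> x) ^ Suc n \<and> (1 - \<beta> x) ^ Suc n \<le> 1" for n x
      using \<beta>01[of x] by (intro conjI zero_le_power power_le_one) auto
    then have "\<bar>\<phi> n x\<bar> \<le> 1" for n x by (simp add: \<phi>_def del: power_Suc)
    then show "AE x in lebesgue. norm (indicator {a..b} x * k x * \<phi> n x) \<le> norm (indicator {a..b} x * k x)" for n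
      by (auto simp: abs_mult mult_left_le intro!: AE_I2)
    show "AE x in lebesgue. (\<lambda>n. indicator {a..b} x * k x * \<phi> n x) \<longlonglongrightarrow>
      indicator {a..b} x * k x * indicator {a<..<b} x"
      by (intro AE_I2 tendsto_intros lim)
  qed (use K meas in \<open>auto intro!: borel_measurable_times borel_measurable_indicator borel_measurable_integrable[OF K] integrable_norm
      simp del: norm_mult real_norm_def\<close>)
  moreover have "(LINT x|lebesgue. indicator {a..b} x * k x * \<phi> n x) = 0" for n
  proof -
    have "indicator {a..b} x * k x * \<phi> n x = k x * \<phi> n x" for x
      using \<beta>0[of x] by (auto simp: indicator_def \<phi>_def)
    then show ?thesis by (simp only: test[OF C1])
  qed
  ultimately have "(LINT x|lebesgue. indicator {a..b} x * k x * indicator {a<..<b} x) = 0"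
    by (simp add: LIMSEQ_const_iff)
  moreover have "(LINT x|lebesgue. indicator {a..b} x * k x * indicator {a<..<b} x)
      = (LINT x|lebesgue. indicator {a..b} x * k x)"
  proof (rule integral_cong_AE)
    have "AE x in lebesgue. x \<noteq> a \<and> x \<noteq> b"
      by (intro AE_completion AE_conjI AE_lborel_singleton)
    then show "AE x in lebesgue. indicator {a..b} x * k x * indicator {a<..<b} x = indicator {a..b} x * k x"
      by eventually_elim (auto simp: indicator_def)
  qed (use K in \<open>auto intro!: borel_measurable_times borel_measurable_indicator borel_measurable_integrable[OF K]\<close>)
  ultimately show ?thesis by (simp add: set_lebesgue_integral_def)
qed

text \<open>Cut off to a compact interval inside \<open>U\<close>, the function \<open>k\<close> has
  zero integral over every interval, hence vanishes almost everywhere there. Countably many such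
  intervals cover \<open>U\<close>.\<close>

lemma fundamental_lemma_variations:
  fixes k :: "real \<Rightarrow> real"
  assumes U: "open U"
    and int: "\<And>a b. {a..b} \<subseteq> U \<Longrightarrow> set_integrable lebesgue {a..b} k"
    and test: "\<And>\<phi>. C1_compact U \<phi> \<Longrightarrow> (LINT x|lebesgue. k x * \<phi> x) = 0"
  shows "AE x in lebesgue. x \<in> U \<longrightarrow> k x = 0"
proof -
  have local: "AE x in lebesgue. x \<in> {c..d} \<longrightarrow> k x = 0" if cd: "{c..d} \<subseteq> U" for c d
  proof -
    have "AE x in lebesgue. indicator {c..d} x * k x = 0"
    proof (rule AE_zero_of_interval_integrals)
      show "integrable lebesgue (\<lambda>x. indicator {c..d} x * k x)"
        using int[OF cd] by (simp add: set_integrable_def)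
      fix a b :: real
      have "(LINT x:{a..b}|lebesgue. indicator {c..d} x * k x) = (LINT x:{max a c..min b d}|lebesgue. k x)"
        unfolding set_lebesgue_integral_def
        by (rule Bochner_Integration.integral_cong) (auto simp: indicator_def)
      also have "\<dots> = 0"
      proof (cases "max a c < min b d")
        case True
        have "{max a c..min b d} \<subseteq> U" using cd by auto
        then show ?thesis using True by (intro interval_integral_zero_of_C1_compact int test)
      next
        case False
        have "AE x in lebesgue. x \<noteq> max a c" by (intro AE_completion AE_lborel_singleton)
        then have "AE x in lebesgue. indicator {max a c..min b d} x *\<^sub>R k x = 0"
          by eventually_elim (use False in \<open>auto simp: indicator_def\<close>)
        then show ?thesis
          unfolding set_lebesgue_integral_def by (rule integral_eq_zero_AE)
      qed
      finally show "(LINT x:{a..b}|lebesgue. indicator {c..d} x * k x) = 0" .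
    qed
    then show ?thesis by eventually_elim (auto simp: indicator_def)
  qed
  \<comment> \<open>Rational endpoints keep the union of the exceptional null sets countable, and
    every point of \<open>U\<close> lies in such an interval.\<close>
  have "AE x in lebesgue. \<forall>q\<in>\<rat> \<times> \<rat>. {fst q..snd q} \<subseteq> U \<longrightarrow> x \<in> {fst q..snd q} \<longrightarrow> k x = 0"
    using local by (subst AE_ball_countable) (auto simp: countable_rat)
  then show ?thesis
  proof eventually_elim
    case (elim x)
    show ?case
    proof
      assume "x \<in> U"
      then obtain e where e: "e > 0" "ball x e \<subseteq> U" using U by (meson open_contains_ball)
      obtain c where c: "c \<in> \<rat>" "x - e < c" "c < x" using Rats_dense_in_real[of "x - e" x] e by auto
      obtain d where d: "d \<in> \<rat>" "x < d" "d < x + e" using Rats_dense_in_real[of x "x + e"] e by auto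
      have "{c..d} \<subseteq> ball x e" using c d by (auto simp: dist_real_def)
      then show "k x = 0" using elim c d e by force
    qed
  qed
qed

section \<open>Weak derivatives\<close>

lemma L2_on_continuous_supported:
  assumes "continuous_on UNIV f" and "\<And>x. x \<notin> {a..b} \<Longrightarrow> f x = 0" and "I \<in> sets lebesgue"
  shows "L2_on I f"
  unfolding L2_on_def
proof
  show "f \<in> borel_measurable (lebesgue_on I)"
    using assms continuous_on_subset by (intro continuous_imp_measurable_on_sets_lebesgue) blast+
  show "integrable (lebesgue_on I) (\<lambda>x. (f x)\<^sup>2)"
    using assms by (intro integrable_continuous_supported[of _ a b] continuous_intros) auto
qed

lemma L2_on_times_integrable:
  assumes g: "L2_on I g" and h: "L2_on I h"
  shows "integrable (lebesgue_on I) (\<lambda>x. g x * h x)"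
proof (rule Bochner_Integration.integrable_bound)
  show "integrable (lebesgue_on I) (\<lambda>x. (g x)\<^sup>2 + (h x)\<^sup>2)"
    using g h by (simp add: L2_on_def)
  show "(\<lambda>x. g x * h x) \<in> borel_measurable (lebesgue_on I)"
    using g h unfolding L2_on_def by (intro borel_measurable_times) blast+
  have "\<bar>y * z\<bar> \<le> y\<^sup>2 + z\<^sup>2" for y z :: real
  proof -
    have "2 * (\<bar>y\<bar> * \<bar>z\<bar>) \<le> y\<^sup>2 + z\<^sup>2"
      using zero_le_power2[of "\<bar>y\<bar> - \<bar>z\<bar>"] by (simp add: power2_diff)
    moreover have "0 \<le> \<bar>y\<bar> * \<bar>z\<bar>" by simp
    ultimately show ?thesis by (simp only: abs_mult)
  qed
  then show "AE x in lebesgue_on I. norm (g x * h x) \<le> norm ((g x)\<^sup>2 + (h x)\<^sup>2)"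
    by simp
qed

text \<open>A point outside \<open>S\<close> lies in the open complement of the closed support,
  where \<open>f\<close> is identically zero.\<close>

lemma C1_compact_eq_0:
  assumes "C1_compact S f" and "x \<notin> S"
  shows "f x = 0" and "deriv f x = 0"
proof -
  let ?K = "closure {x. f x \<noteq> 0}"
  have x: "x \<notin> ?K" using assms by (auto simp: C1_compact_def)
  have out: "f y = 0" if "y \<in> - ?K" for y
    using that closure_subset[of "{x. f x \<noteq> 0}"] by blast
  then show "f x = 0" using x by blast
  have "((\<lambda>x. 0) has_real_derivative 0) (at x)" by simp
  then have "(f has_real_derivative 0) (at x)"
  proof (rule has_field_derivative_transform_within_open)
    show "open (- ?K)" by (rule open_Compl) (rule closed_closure)
    show "x \<in> - ?K" using x by blast
    show "0 = f y" if "y \<in> - ?K" for y using out[OF that] by (rule sym)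
  qed
  then show "deriv f x = 0" by (rule DERIV_imp_deriv)
qed

lemma C1_compact_L2:
  assumes "C1_compact S f" and "I \<in> sets lebesgue"
  shows "L2_on I f"
proof -
  obtain a b where "\<And>x. (f has_real_derivative deriv f x) (at x)"
      "\<And>x. x \<notin> {a<..<b} \<Longrightarrow> f x = 0" "a \<le> b"
    using assms(1) by (rule C1_compactE) blast
  moreover from this(1) have "continuous_on UNIV f"
    using DERIV_continuous_on by blast
  moreover have "f x = 0" if "x \<notin> {a..b}" for x
  proof -
    have "x \<notin> {a<..<b}" using that by auto
    then show ?thesis using calculation by blast
  qed
  ultimately show ?thesis
    using assms(2) L2_on_continuous_supported by blast
qed

text \<open>The difference of two weak derivatives is orthogonal to all test functions, so the
  fundamental lemma makes it vanish almost everywhere in the interior; by \<open>bd\<close> the rest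
  of \<open>I\<close> is a null set.\<close>

lemma weak_derivative_unique:
  assumes I: "I \<in> sets lebesgue" and bd: "AE x in lebesgue. x \<in> I \<longrightarrow> x \<in> interior I"
    and g: "weak_derivative I f g" and h: "weak_derivative I f h"
  shows "AE x in lebesgue_on I. g x = h x"
proof -
  have L2: "L2_on I g" "L2_on I h" using g h by (auto simp: weak_derivative_def)
  define k where "k x = indicator I x * (g x - h x)" for x
  have "AE x in lebesgue. x \<in> interior I \<longrightarrow> k x = 0"
  proof (rule fundamental_lemma_variations)
    fix a b assume ab: "{a..b} \<subseteq> interior I"
    then have abI: "{a..b} \<subseteq> I" using interior_subset by blast
    have sub: "L2_on {a..b} g'" if "L2_on I g'" for g'
    proof -
      have "integrable lebesgue (\<lambda>x. indicator I x *\<^sub>R (g' x)\<^sup>2)"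
        using that I by (simp add: L2_on_def integrable_restrict_space)
      then have "integrable lebesgue (\<lambda>x. indicator {a..b} x *\<^sub>R indicator I x *\<^sub>R (g' x)\<^sup>2)"
        by (rule integrable_mult_indicator[rotated]) simp
      also have "(\<lambda>x. indicator {a..b} x *\<^sub>R indicator I x *\<^sub>R (g' x)\<^sup>2) = (\<lambda>x. indicator {a..b} x *\<^sub>R (g' x)\<^sup>2)"
        using abI by (auto simp: indicator_def fun_eq_iff)
      finally have "integrable (lebesgue_on {a..b}) (\<lambda>x. (g' x)\<^sup>2)"
        by (simp add: integrable_restrict_space)
      then show ?thesis
        using that abI by (auto simp: L2_on_def intro: measurable_restrict_mono)
    qed
    \<comment> \<open>Pairing with the constant 1 turns square integrability on a bounded interval
      into the integrability that the fundamental lemma asks for.\<close>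
    have one: "L2_on {a..b} (\<lambda>x. 1)"
      by (auto simp: L2_on_def)
    have "integrable (lebesgue_on {a..b}) (\<lambda>x. g x * 1 - h x * 1)"
      by (intro Bochner_Integration.integrable_diff L2_on_times_integrable sub L2 one)
    then have "integrable lebesgue (\<lambda>x. indicator {a..b} x * (g x - h x))"
      by (simp add: integrable_restrict_space)
    moreover have "indicator {a..b} x * (g x - h x) = indicator {a..b} x *\<^sub>R k x" for x
      using abI by (auto simp: k_def indicator_def)
    ultimately show "set_integrable lebesgue {a..b} k"
      by (simp add: set_integrable_def)
  next
    fix \<phi> assume \<phi>: "C1_compact (interior I) \<phi>"
    have "(LINT x|lebesgue. k x * \<phi> x) = (LINT x|lebesgue_on I. g x * \<phi> x - h x * \<phi> x)"
      using I by (simp add: integral_restrict_space k_def algebra_simps)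
    also have "\<dots> = (LINT x|lebesgue_on I. g x * \<phi> x) - (LINT x|lebesgue_on I. h x * \<phi> x)"
      by (intro Bochner_Integration.integral_diff L2_on_times_integrable L2 C1_compact_L2[OF \<phi> I])
    also have "\<dots> = 0"
    proof -
      have "(LINT x|lebesgue_on I. f x * deriv \<phi> x) = - (LINT x|lebesgue_on I. g x * \<phi> x)"
        "(LINT x|lebesgue_on I. f x * deriv \<phi> x) = - (LINT x|lebesgue_on I. h x * \<phi> x)"
        using g h \<phi> by (auto simp: weak_derivative_def)
      then show ?thesis by simp
    qed
    finally show "(LINT x|lebesgue. k x * \<phi> x) = 0" .
  qed simp
  with bd have "AE x in lebesgue. x \<in> I \<longrightarrow> g x = h x"
    by eventually_elim (auto simp: k_def)
  then show ?thesis using I by (simp add: AE_restrict_space_iff)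
qed

text \<open>Integration by parts: the derivative of \<open>f * \<phi>\<close> integrates to 0
  because \<open>\<phi>\<close> has compact support in the interior of \<open>I\<close>. The compact
  support of \<open>f'\<close> provides its square integrability.\<close>

lemma weak_derivative_classical:
  assumes I: "I \<in> sets lebesgue"
    and der: "\<And>x. (f has_real_derivative f' x) (at x)" and cont: "continuous_on UNIV f'"
    and supp: "\<And>x. x \<notin> {a..b} \<Longrightarrow> f' x = 0"
  shows "weak_derivative I f f'"
  unfolding weak_derivative_def
proof (intro conjI allI impI)
  show "L2_on I f'" using cont supp I by (rule L2_on_continuous_supported)
  fix \<phi> assume \<phi>: "C1_compact (interior I) \<phi>"
  obtain c d where cd: "\<And>x. (\<phi> has_real_derivative deriv \<phi> x) (at x)" "continuous_on UNIV (deriv \<phi>)"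
    "\<And>x. x \<notin> {c<..<d} \<Longrightarrow> \<phi> x = 0" "\<And>x. x \<notin> {c<..<d} \<Longrightarrow> deriv \<phi> x = 0" "c \<le> d"
    using \<phi> by (rule C1_compactE) blast
  have cf: "continuous_on UNIV f" and c\<phi>: "continuous_on UNIV \<phi>"
    using der cd(1) DERIV_continuous_on by blast+
  have out: "\<phi> x = 0" "deriv \<phi> x = 0" if "x \<notin> {c..d}" for x
  proof -
    have "x \<notin> {c<..<d}" using that by auto
    then show "\<phi> x = 0" "deriv \<phi> x = 0" by (rule cd)+
  qed
  have int: "integrable (lebesgue_on I) (\<lambda>x. f x * deriv \<phi> x)" "integrable (lebesgue_on I) (\<lambda>x. f' x * \<phi> x)"
    by (intro integrable_continuous_supported[of _ c d] continuous_intros cf c\<phi> cont cd(2) I; simp add: out)+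
  \<comment> \<open>The interval \<open>{c..d}\<close> may stick out of \<open>I\<close>, so the
    integral is first moved to the whole line; \<open>\<phi>\<close> and its derivative vanish off
    \<open>I\<close>.\<close>
  have "(LINT x|lebesgue_on I. f' x * \<phi> x + f x * deriv \<phi> x)
      = (LINT x|lebesgue_on UNIV. f' x * \<phi> x + f x * deriv \<phi> x)"
  proof -
    have "indicator I x *\<^sub>R (f' x * \<phi> x + f x * deriv \<phi> x) = f' x * \<phi> x + f x * deriv \<phi> x" for x
    proof (cases "x \<in> I")
      case False
      then have "x \<notin> interior I" using interior_subset by blast
      with C1_compact_eq_0[OF \<phi>] have "\<phi> x = 0" "deriv \<phi> x = 0" by blast+
      then show ?thesis by simp
    qed simp
    then have "(\<lambda>x. indicator I x *\<^sub>R (f' x * \<phi> x + f x * deriv \<phi> x)) = (\<lambda>x. f' x * \<phi> x + f x * deriv \<phi> x)"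
      by (rule ext)
    moreover have "I \<inter> space lebesgue \<in> sets lebesgue" using I by simp
    ultimately show ?thesis by (simp only: integral_restrict_space lebesgue_on_UNIV_eq)
  qed
  also have "\<dots> = 0"
  proof (rule integral_deriv_supported[of "\<lambda>x. f x * \<phi> x" _ c d])
    show "((\<lambda>x. f x * \<phi> x) has_real_derivative f' x * \<phi> x + f x * deriv \<phi> x) (at x)" for x
      using DERIV_mult[OF der cd(1)] by (simp add: algebra_simps)
    show "continuous_on UNIV (\<lambda>x. f' x * \<phi> x + f x * deriv \<phi> x)"
      by (intro continuous_intros cf c\<phi> cont cd(2))
    show "f x * \<phi> x = 0" if "x \<notin> {c<..<d}" for x using cd(3)[OF that] by simp
    show "f' x * \<phi> x + f x * deriv \<phi> x = 0" if "x \<notin> {c..d}" for x using out[OF that] by simp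
  qed (use cd(5) in simp_all)
  finally show "(LINT x|lebesgue_on I. f x * deriv \<phi> x) = - (LINT x|lebesgue_on I. f' x * \<phi> x)"
    using int by simp
qed

text \<open>As soon as one weak derivative exists, the choice in \<open>wderiv\<close> does return a
  weak derivative; uniqueness identifies it with the known one.\<close>

lemma wderiv_AE_eq:
  assumes "I \<in> sets lebesgue" and "AE x in lebesgue. x \<in> I \<longrightarrow> x \<in> interior I"
    and "weak_derivative I f g"
  shows "AE x in lebesgue_on I. wderiv I f x = g x"
proof -
  have w: "weak_derivative I f (wderiv I f)"
    unfolding wderiv_def using assms(3) by (rule someI[of "weak_derivative I f"])
  show ?thesis by (rule weak_derivative_unique[OF assms(1,2) w assms(3)])
qed

lemma edge_interval_lebesgue:
  assumes "wf_metric_graph G" and "e \<in> edges G"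
  shows "edge_interval G e \<in> sets lebesgue"
    and "AE x in lebesgue. x \<in> edge_interval G e \<longrightarrow> x \<in> interior (edge_interval G e)"
proof -
  have "0 < len G e" using assms by (auto simp: wf_metric_graph_def)
  then consider "edge_interval G e = {0..}" | r where "edge_interval G e = {0..r}"
  proof (cases "len G e")
    case (real r)
    then have "edge_interval G e = {0..r}" by (auto simp: edge_interval_def)
    then show ?thesis using that(2) by blast
  next
    case PInf
    then have "edge_interval G e = {0..}" by (auto simp: edge_interval_def)
    then show ?thesis using that(1) by blast
  qed (use \<open>0 < len G e\<close> in simp)
  then have "edge_interval G e \<in> sets lebesgue \<and>
    (AE x in lebesgue. x \<in> edge_interval G e \<longrightarrow> x \<in> interior (edge_interval G e))"
  proof cases
    case 1
    have "AE x in lebesgue. x \<noteq> (0::real)" by (intro AE_completion AE_lborel_singleton)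
    then have "AE x in lebesgue. x \<in> {0..} \<longrightarrow> x \<in> interior {0::real..}"
      by eventually_elim auto
    with 1 show ?thesis by simp
  next
    case (2 r)
    have "AE x in lebesgue. x \<noteq> (0::real) \<and> x \<noteq> r"
      by (intro AE_completion AE_conjI AE_lborel_singleton)
    then have "AE x in lebesgue. x \<in> {0..r} \<longrightarrow> x \<in> interior {0..r}"
      by eventually_elim auto
    with 2 show ?thesis by simp
  qed
  then show "edge_interval G e \<in> sets lebesgue"
    "AE x in lebesgue. x \<in> edge_interval G e \<longrightarrow> x \<in> interior (edge_interval G e)" by auto
qed

section \<open>Functions supported on a half-line\<close>

lemma edge_pt_in_points:
  assumes "wf_metric_graph G" and "e \<in> edges G" and "x \<in> edge_interval G e"
  shows "edge_pt G e x \<in> points G"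
  using assms unfolding wf_metric_graph_def edge_interval_def edge_pt_def points_def
  by (auto simp: less_le)

lemma topspace_graph_topology:
  assumes "wf_metric_graph G"
  shows "topspace (graph_topology G) = points G"
proof (rule antisym)
  show "topspace (graph_topology G) \<subseteq> points G"
    using openin_graph_topology openin_topspace by metis
  have "openin (graph_topology G) (points G)"
    unfolding openin_graph_topology
  proof (intro conjI ballI)
    fix e assume "e \<in> edges G"
    then have "{x \<in> edge_interval G e. edge_pt G e x \<in> points G} = edge_interval G e"
      using edge_pt_in_points[OF assms] by auto
    then show "openin (top_of_set (edge_interval G e)) {x \<in> edge_interval G e. edge_pt G e x \<in> points G}"
      by simp
  qed simp
  then show "points G \<subseteq> topspace (graph_topology G)" by (rule openin_subset)
qed

lemma continuous_map_edge_pt: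
  assumes "wf_metric_graph G" and "e \<in> edges G"
  shows "continuous_map (top_of_set (edge_interval G e)) (graph_topology G) (edge_pt G e)"
  unfolding continuous_map_def topspace_graph_topology[OF assms(1)]
  using edge_pt_in_points[OF assms] assms(2) by (auto simp: openin_graph_topology Pi_iff)

lemma continuous_on_edge:
  assumes "wf_metric_graph G" and "e \<in> edges G"
    and "continuous_map (graph_topology G) euclideanreal u"
  shows "continuous_on (edge_interval G e) (on_edge G u e)"
  using continuous_map_compose[OF continuous_map_edge_pt[OF assms(1,2)] assms(3)]
  by (simp add: comp_def on_edge_def[abs_def])

text \<open>Universal property of the gluing topology: the preimage of an open set is open because
  its trace on each edge is.\<close>

lemma continuous_map_graphI:
  assumes "wf_metric_graph G" and cont: "\<And>e. e \<in> edges G \<Longrightarrow> continuous_on (edge_interval G e) (on_edge G u e)"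
  shows "continuous_map (graph_topology G) euclideanreal u"
  unfolding continuous_map_def topspace_graph_topology[OF assms(1)]
proof (intro conjI allI impI)
  fix U :: "real set" assume "openin euclideanreal U"
  then have U: "open U" by simp
  show "openin (graph_topology G) {q \<in> points G. u q \<in> U}"
    unfolding openin_graph_topology
  proof (intro conjI ballI)
    fix e assume e: "e \<in> edges G"
    have "{x \<in> edge_interval G e. edge_pt G e x \<in> {q \<in> points G. u q \<in> U}}
        = edge_interval G e \<inter> on_edge G u e -` U"
      using edge_pt_in_points[OF assms(1) e] by (auto simp: on_edge_def)
    then show "openin (top_of_set (edge_interval G e))
        {x \<in> edge_interval G e. edge_pt G e x \<in> {q \<in> points G. u q \<in> U}}"
      using continuous_openin_preimage_gen[OF cont[OF e] U] by simp
  qed auto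
qed simp

text \<open>Extension by zero from the half-line to the graph. The guard \<open>0 < x\<close> gives
  the value 0 to the terms \<open>Inner h x\<close> that are not points of the graph, as the
  normalisation of \<open>H1_graph\<close> and \<open>Cc_graph\<close> demands.\<close>

definition line_fun :: "'e \<Rightarrow> (real \<Rightarrow> real) \<Rightarrow> ('v, 'e) gpoint \<Rightarrow> real" where
  "line_fun h f q = (case q of Vertex v \<Rightarrow> 0 | Inner e x \<Rightarrow> if e = h \<and> 0 < x then f x else 0)"

lemma on_edge_line_fun:
  assumes "h \<in> half_lines G" and "f 0 = 0" and "x \<in> edge_interval G e"
  shows "on_edge G (line_fun h f) e x = (if e = h then f x else 0)"
  using assms by (auto simp: on_edge_def line_fun_def edge_pt_def edge_interval_def half_lines_def)

lemma half_line_interval: "h \<in> half_lines G \<Longrightarrow> edge_interval G h = {0..}"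
  by (auto simp: half_lines_def edge_interval_def)

lemma half_line_edge: "h \<in> half_lines G \<Longrightarrow> h \<in> edges G"
  by (simp add: half_lines_def)

lemma weak_derivative_cong:
  assumes "\<And>x. x \<in> I \<Longrightarrow> f x = g x"
  shows "weak_derivative I f = weak_derivative I g"
proof -
  have "(LINT x|lebesgue_on I. f x * deriv \<phi> x) = (LINT x|lebesgue_on I. g x * deriv \<phi> x)" for \<phi>
    using assms by (intro Bochner_Integration.integral_cong) auto
  then show ?thesis by (simp add: weak_derivative_def[abs_def])
qed

lemma L2_on_cong:
  assumes "\<And>x. x \<in> I \<Longrightarrow> f x = g x"
  shows "L2_on I f \<longleftrightarrow> L2_on I g"
proof -
  have "f \<in> borel_measurable (lebesgue_on I) \<longleftrightarrow> g \<in> borel_measurable (lebesgue_on I)"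
    using assms by (intro measurable_cong) auto
  moreover have "integrable (lebesgue_on I) (\<lambda>x. (f x)\<^sup>2) \<longleftrightarrow> integrable (lebesgue_on I) (\<lambda>x. (g x)\<^sup>2)"
    using assms by (intro Bochner_Integration.integrable_cong) auto
  ultimately show ?thesis by (simp add: L2_on_def)
qed

text \<open>A C1 profile with compact support in the open half-line. The condition
  \<open>0 < s\<close> keeps the support away from the vertex, so that extending by zero to the
  other edges preserves continuity.\<close>

locale half_line_function =
  fixes G :: "('v, 'e) metric_graph" and h :: 'e and f f' :: "real \<Rightarrow> real" and s t :: real
  assumes wf: "wf_metric_graph G" and h: "h \<in> half_lines G"
    and der: "(f has_real_derivative f' x) (at x)" and cont': "continuous_on UNIV f'"
    and supp: "x \<notin> {s..t} \<Longrightarrow> f x = 0" and supp': "x \<notin> {s..t} \<Longrightarrow> f' x = 0"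
    and s: "0 < s"
begin

lemma cont: "continuous_on UNIV f"
  using der DERIV_continuous_on by blast

lemma f_0: "f 0 = 0"
  using supp[of 0] s by simp

lemmas on_edge_eq = on_edge_line_fun[OF h, where f = f, OF f_0]

lemma weak_derivative_line_fun:
  assumes "e \<in> edges G"
  shows "weak_derivative (edge_interval G e) (on_edge G (line_fun h f) e) (if e = h then f' else (\<lambda>x. 0))"
proof -
  note I = edge_interval_lebesgue(1)[OF wf assms]
  have "weak_derivative (edge_interval G e) (\<lambda>x. if e = h then f x else 0) (if e = h then f' else (\<lambda>x. 0))"
  proof (cases "e = h")
    case True
    then show ?thesis using weak_derivative_classical[OF I der cont' supp'] by simp
  next
    case False
    then show ?thesis using weak_derivative_classical[OF I, of "\<lambda>x. 0" "\<lambda>x. 0"] by simp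
  qed
  moreover have "weak_derivative (edge_interval G e) (on_edge G (line_fun h f) e)
      = weak_derivative (edge_interval G e) (\<lambda>x. if e = h then f x else 0)"
    by (rule weak_derivative_cong[OF on_edge_eq])
  ultimately show ?thesis by (simp only:)
qed

lemma edge_deriv_AE:
  assumes "e \<in> edges G"
  shows "AE x in edge_measure G e. edge_deriv G (line_fun h f) e x = (if e = h then f' x else 0)"
  using wderiv_AE_eq[OF edge_interval_lebesgue[OF wf assms] weak_derivative_line_fun[OF assms]]
  unfolding edge_deriv_def by eventually_elim simp

lemma L2_line_fun:
  assumes "e \<in> edges G"
  shows "L2_on (edge_interval G e) (on_edge G (line_fun h f) e)"
proof -
  have "L2_on (edge_interval G e) (\<lambda>x. if e = h then f x else 0)"
  proof (rule L2_on_continuous_supported)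
    show "continuous_on UNIV (\<lambda>x. if e = h then f x else 0)"
      using cont by (cases "e = h") simp_all
    show "(if e = h then f x else 0) = 0" if "x \<notin> {s..t}" for x
      using supp[OF that] by simp
  qed (rule edge_interval_lebesgue(1)[OF wf assms])
  moreover have "L2_on (edge_interval G e) (on_edge G (line_fun h f) e)
      \<longleftrightarrow> L2_on (edge_interval G e) (\<lambda>x. if e = h then f x else 0)"
    by (rule L2_on_cong[OF on_edge_eq])
  ultimately show ?thesis by (simp only:)
qed

lemma continuous_map_line_fun: "continuous_map (graph_topology G) euclideanreal (line_fun h f)"
proof (rule continuous_map_graphI[OF wf])
  fix e assume "e \<in> edges G"
  have "continuous_on (edge_interval G e) (\<lambda>x. if e = h then f x else 0)"
    using continuous_on_subset[OF cont] by (cases "e = h") simp_all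
  moreover have "continuous_on (edge_interval G e) (on_edge G (line_fun h f) e)
      \<longleftrightarrow> continuous_on (edge_interval G e) (\<lambda>x. if e = h then f x else 0)"
    by (rule continuous_on_cong[OF refl on_edge_eq])
  ultimately show "continuous_on (edge_interval G e) (on_edge G (line_fun h f) e)" by (simp only:)
qed

lemma line_fun_outside: "q \<notin> points G \<Longrightarrow> line_fun h f q = 0"
  using h by (auto simp: line_fun_def points_def half_lines_def split: gpoint.split)

text \<open>Only the edge \<open>h\<close> can contribute to the sum of the squared norms, so
  summability is that of a family with at most one nonzero term.\<close>

lemma line_fun_H1: "line_fun h f \<in> H1_graph G"
proof -
  have "(LINT x|edge_measure G e. (edge_deriv G (line_fun h f) e x)\<^sup>2) +
      (LINT x|edge_measure G e. (on_edge G (line_fun h f) e x)\<^sup>2) = 0" if e: "e \<in> edges G" "e \<noteq> h" for e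
  proof -
    have "(LINT x|edge_measure G e. (edge_deriv G (line_fun h f) e x)\<^sup>2) = 0"
      using edge_deriv_AE[OF e(1)] e by (intro integral_eq_zero_AE) auto
    moreover have "(LINT x|edge_measure G e. (on_edge G (line_fun h f) e x)\<^sup>2) = (LINT x|edge_measure G e. 0)"
      using e on_edge_eq by (intro Bochner_Integration.integral_cong) auto
    ultimately show ?thesis by simp
  qed
  then have "{e \<in> edges G. (LINT x|edge_measure G e. (edge_deriv G (line_fun h f) e x)\<^sup>2) +
      (LINT x|edge_measure G e. (on_edge G (line_fun h f) e x)\<^sup>2) \<noteq> 0} \<subseteq> {h}"
    by blast
  then have "(\<lambda>e. (LINT x|edge_measure G e. (edge_deriv G (line_fun h f) e x)\<^sup>2) +
      (LINT x|edge_measure G e. (on_edge G (line_fun h f) e x)\<^sup>2)) summable_on edges G"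
    by (intro finite_nonzero_values_imp_summable_on) (rule finite_subset, assumption, simp)
  moreover have "\<forall>e\<in>edges G. H1_on (edge_interval G e) (on_edge G (line_fun h f) e)"
    unfolding H1_on_def using L2_line_fun weak_derivative_line_fun by blast
  moreover have "\<forall>q. q \<notin> points G \<longrightarrow> line_fun h f q = 0"
    using line_fun_outside by blast
  ultimately show ?thesis
    unfolding H1_graph_def using continuous_map_line_fun by simp
qed

text \<open>The support sits in the image of \<open>{s..t}\<close> under \<open>edge_pt G h\<close>.
  This image is compact by continuity, and closed because its trace on \<open>h\<close> is
  \<open>{s..t}\<close> and its trace on every other edge is empty.\<close>

lemma line_fun_Cc: "line_fun h f \<in> Cc_graph G"
proof -
  let ?K = "edge_pt G h ` {s..t}"
  note hE = half_line_edge[OF h]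
  have sub: "{s..t} \<subseteq> edge_interval G h"
    using s by (auto simp: half_line_interval[OF h])
  have "compactin (top_of_set (edge_interval G h)) {s..t}"
    using sub by (simp add: compactin_subtopology)
  then have K: "compactin (graph_topology G) ?K"
    using continuous_map_edge_pt[OF wf hE] by (rule image_compactin)
  have KP: "?K \<subseteq> points G"
    using sub edge_pt_in_points[OF wf hE] by auto
  have "openin (graph_topology G) (points G - ?K)"
    unfolding openin_graph_topology
  proof (intro conjI ballI)
    fix e assume e: "e \<in> edges G"
    have Inner: "edge_pt G h y = Inner h y" if "y \<in> {s..t}" for y
      using that s h by (auto simp: edge_pt_def half_lines_def)
    have mem: "edge_pt G e x \<in> ?K \<longleftrightarrow> e = h \<and> x \<in> {s..t}" if "x \<in> edge_interval G e" for x
    proof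
      assume "edge_pt G e x \<in> ?K"
      then obtain y where "y \<in> {s..t}" "edge_pt G e x = Inner h y" using Inner by auto
      then show "e = h \<and> x \<in> {s..t}" by (auto simp: edge_pt_def split: if_splits)
    qed auto
    have "{x \<in> edge_interval G e. edge_pt G e x \<in> points G - ?K}
        = edge_interval G e \<inter> (if e = h then - {s..t} else UNIV)"
    proof (rule set_eqI)
      fix x
      show "x \<in> {x \<in> edge_interval G e. edge_pt G e x \<in> points G - ?K}
          \<longleftrightarrow> x \<in> edge_interval G e \<inter> (if e = h then - {s..t} else UNIV)"
        using mem[of x] edge_pt_in_points[OF wf e, of x]
        by (cases "x \<in> edge_interval G e"; cases "e = h") simp_all
    qed
    moreover have "open (if e = h then - {s..t} else UNIV)"
      by (auto intro: open_Compl)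
    ultimately show "openin (top_of_set (edge_interval G e))
        {x \<in> edge_interval G e. edge_pt G e x \<in> points G - ?K}"
      by (simp add: openin_open_Int)
  qed auto
  then have "closedin (graph_topology G) ?K"
    using KP by (simp add: closedin_def topspace_graph_topology[OF wf])
  moreover have "{q \<in> points G. line_fun h f q \<noteq> 0} \<subseteq> ?K"
  proof
    fix q assume "q \<in> {q \<in> points G. line_fun h f q \<noteq> 0}"
    then obtain x where x: "q = Inner h x" "f x \<noteq> 0" "0 < x"
      by (auto simp: line_fun_def split: gpoint.splits if_splits)
    then have "x \<in> {s..t}" using supp by blast
    moreover from x h have "q = edge_pt G h x" by (auto simp: edge_pt_def half_lines_def)
    ultimately show "q \<in> ?K" by blast
  qed
  ultimately have "graph_topology G closure_of {q \<in> points G. line_fun h f q \<noteq> 0} \<subseteq> ?K"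
    by (simp add: closure_of_minimal)
  then have "compactin (graph_topology G) (graph_topology G closure_of {q \<in> points G. line_fun h f q \<noteq> 0})"
    using K by (meson closed_compactin closedin_closure_of)
  then show ?thesis
    unfolding Cc_graph_def using line_fun_outside continuous_map_line_fun by simp
qed

end

section \<open>The quadratic form on functions supported far out on a half-line\<close>

text \<open>A bound on the support of \<open>f\<close> is enough. This covers coefficients such as
  \<open>\<rho> |u|^(p-2)\<close>, which is controlled on the compact interval by the continuity of
  \<open>u\<close>.\<close>

lemma (in half_line_function) integrable_times_f_squared:
  assumes "g \<in> borel_measurable (edge_measure G h)"
    and "AE x in edge_measure G h. x \<in> {s..t} \<longrightarrow> \<bar>g x\<bar> \<le> C"
  shows "integrable (edge_measure G h) (\<lambda>x. g x * (f x)\<^sup>2)"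
proof (rule Bochner_Integration.integrable_bound)
  note I = edge_interval_lebesgue(1)[OF wf half_line_edge[OF h]]
  have f2: "integrable (edge_measure G h) (\<lambda>x. (f x)\<^sup>2)"
    by (rule integrable_continuous_supported[of _ s t]) (intro continuous_intros cont, simp add: supp, rule I)
  then show "integrable (edge_measure G h) (\<lambda>x. C * (f x)\<^sup>2)" by simp
  show "(\<lambda>x. g x * (f x)\<^sup>2) \<in> borel_measurable (edge_measure G h)"
    using assms(1) borel_measurable_integrable[OF f2] by (rule borel_measurable_times)
  show "AE x in edge_measure G h. norm (g x * (f x)\<^sup>2) \<le> norm (C * (f x)\<^sup>2)"
    using assms(2)
  proof eventually_elim
    case (elim x)
    show ?case
    proof (cases "x \<in> {s..t}")
      case True
      with elim have "\<bar>g x\<bar> \<le> \<bar>C\<bar>" by linarith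
      then show ?thesis by (simp add: abs_mult mult_right_mono)
    next
      case False
      then show ?thesis using supp[OF False] by simp
    qed
  qed
qed

text \<open>Edges other than \<open>h\<close> contribute 0. On \<open>h\<close> the chosen weak
  derivative is almost everywhere \<open>f'\<close>, the potential term is at most
  \<open>- d * f^2\<close>, and the term with \<open>\<rho>\<close> enters with a minus sign and is
  dropped.\<close>

lemma (in half_line_function) morse_form_line_fun_le:
  assumes W: "Linf_graph G W" and \<rho>: "Linf_graph G \<rho>" and u: "u \<in> H1_graph G" and p: "2 < p"
    and \<rho>_nonneg: "AE x in edge_measure G h. 0 \<le> on_edge G \<rho> h x"
    and W_le: "AE x in edge_measure G h. s \<le> x \<longrightarrow> on_edge G W h x + lam \<le> - d"
  shows "morse_form G p W \<rho> lam u (line_fun h f) \<le> integral {s..t} (\<lambda>x. (f' x)\<^sup>2 - d * (f x)\<^sup>2)"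
proof -
  let ?M = "edge_measure G h" and ?\<phi> = "line_fun h f"
  let ?F = "\<lambda>e x. (edge_deriv G ?\<phi> e x)\<^sup>2 + (on_edge G W e x + lam) * (on_edge G ?\<phi> e x)\<^sup>2
      - (p - 1) * on_edge G \<rho> e x * \<bar>on_edge G u e x\<bar> powr (p - 2) * (on_edge G ?\<phi> e x)\<^sup>2"
  let ?F2 = "\<lambda>x. (f' x)\<^sup>2 + (on_edge G W h x + lam) * (f x)\<^sup>2
      - (p - 1) * on_edge G \<rho> h x * \<bar>on_edge G u h x\<bar> powr (p - 2) * (f x)\<^sup>2"
  let ?F3 = "\<lambda>x. (f' x)\<^sup>2 - d * (f x)\<^sup>2"
  note hE = half_line_edge[OF h]
  note I = edge_interval_lebesgue(1)[OF wf hE]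
  have zero: "(LINT x|edge_measure G e. ?F e x) = 0" if e: "e \<in> edges G" "e \<noteq> h" for e
  proof (rule integral_eq_zero_AE)
    have "AE x in edge_measure G e. x \<in> space (edge_measure G e)" by (rule AE_space)
    with edge_deriv_AE[OF e(1)] show "AE x in edge_measure G e. ?F e x = 0"
    proof eventually_elim
      case (elim x)
      then have "on_edge G ?\<phi> e x = 0" using on_edge_eq[of x e] e(2) by simp
      then show ?case using elim e(2) by simp
    qed
  qed
  have "morse_form G p W \<rho> lam u ?\<phi> = (\<Sum>\<^sub>\<infinity>e\<in>edges G. LINT x|edge_measure G e. ?F e x)"
    by (simp add: morse_form_def graph_integral_def)
  also have "\<dots> = (\<Sum>\<^sub>\<infinity>e\<in>{h}. LINT x|edge_measure G e. ?F e x)"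
    by (rule infsum_cong_neutral) (use zero hE in blast)+
  also have "\<dots> = (LINT x|?M. ?F h x)" by simp
  also have "\<dots> = (LINT x|?M. ?F2 x)"
  proof (rule integral_cong_AE)
    have W': "on_edge G W h \<in> borel_measurable ?M" and \<rho>': "on_edge G \<rho> h \<in> borel_measurable ?M"
      using W \<rho> hE unfolding Linf_graph_def by blast+
    have u': "on_edge G u h \<in> borel_measurable ?M"
      using u hE unfolding H1_graph_def H1_on_def L2_on_def by blast
    have \<phi>: "on_edge G ?\<phi> h \<in> borel_measurable ?M"
      using L2_line_fun[OF hE] unfolding L2_on_def by blast
    have "weak_derivative (edge_interval G h) (on_edge G ?\<phi> h) (edge_deriv G ?\<phi> h)"
      unfolding edge_deriv_def wderiv_def
      by (rule someI[of "weak_derivative (edge_interval G h) (on_edge G ?\<phi> h)", OF weak_derivative_line_fun[OF hE]])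
    then have d: "edge_deriv G ?\<phi> h \<in> borel_measurable ?M"
      unfolding weak_derivative_def L2_on_def by blast
    have f': "f' \<in> borel_measurable ?M" and f: "f \<in> borel_measurable ?M"
      using continuous_on_subset[OF cont'] continuous_on_subset[OF cont] I
      by (auto intro: continuous_imp_measurable_on_sets_lebesgue)
    show "?F h \<in> borel_measurable ?M"
      using W' \<rho>' u' \<phi> d by measurable
    show "?F2 \<in> borel_measurable ?M"
      using W' \<rho>' u' f f' by measurable
    have "AE x in ?M. x \<in> space ?M" by (rule AE_space)
    with edge_deriv_AE[OF hE] show "AE x in ?M. ?F h x = ?F2 x"
    proof eventually_elim
      case (elim x)
      then have "on_edge G ?\<phi> h x = f x" using on_edge_eq[of x h] by simp
      then show ?case using elim by simp
    qed
  qed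
  also have "\<dots> \<le> (LINT x|?M. ?F3 x)"
  proof (rule integral_mono_AE)
    have f'2: "integrable ?M (\<lambda>x. (f' x)\<^sup>2)"
      by (rule integrable_continuous_supported[of _ s t]) (intro continuous_intros cont', simp add: supp', rule I)
    have f2: "integrable ?M (\<lambda>x. d * (f x)\<^sup>2)"
      by (rule integrable_times_f_squared[of _ "\<bar>d\<bar>"]) simp_all
    \<comment> \<open>Monotonicity of the integral requires both sides to be integrable; the
      essential bounds of \<open>W\<close> and \<open>\<rho>\<close> and the bound of
      \<open>u\<close> on \<open>{s..t}\<close> serve this purpose.\<close>
    obtain CW where CW: "AE x in ?M. \<bar>on_edge G W h x\<bar> \<le> CW"
      using W hE unfolding Linf_graph_def by blast
    obtain C\<rho> where C\<rho>: "AE x in ?M. \<bar>on_edge G \<rho> h x\<bar> \<le> C\<rho>"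
      using \<rho> hE unfolding Linf_graph_def by blast
    have W': "on_edge G W h \<in> borel_measurable ?M" and \<rho>': "on_edge G \<rho> h \<in> borel_measurable ?M"
      using W \<rho> hE unfolding Linf_graph_def by blast+
    have u': "on_edge G u h \<in> borel_measurable ?M"
      using u hE unfolding H1_graph_def H1_on_def L2_on_def by blast
    have "continuous_map (graph_topology G) euclideanreal u"
      using u unfolding H1_graph_def by blast
    then have "continuous_on (edge_interval G h) (on_edge G u h)"
      by (rule continuous_on_edge[OF wf hE])
    then have "continuous_on {s..t} (on_edge G u h)"
      by (rule continuous_on_subset) (use s in \<open>auto simp: half_line_interval[OF h]\<close>)
    then have "bounded (on_edge G u h ` {s..t})"
      by (intro compact_imp_bounded compact_continuous_image) simp_all
    then obtain B where B: "\<And>x. x \<in> {s..t} \<Longrightarrow> \<bar>on_edge G u h x\<bar> \<le> B"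
      unfolding bounded_iff by (metis imageI real_norm_def)
    have W_int: "integrable ?M (\<lambda>x. (on_edge G W h x + lam) * (f x)\<^sup>2)"
    proof (rule integrable_times_f_squared[of _ "CW + \<bar>lam\<bar>"])
      show "(\<lambda>x. on_edge G W h x + lam) \<in> borel_measurable ?M" using W' by measurable
      show "AE x in ?M. x \<in> {s..t} \<longrightarrow> \<bar>on_edge G W h x + lam\<bar> \<le> CW + \<bar>lam\<bar>"
        using CW by eventually_elim linarith
    qed
    have \<rho>_int: "integrable ?M (\<lambda>x. (p - 1) * on_edge G \<rho> h x * \<bar>on_edge G u h x\<bar> powr (p - 2) * (f x)\<^sup>2)"
    proof (rule integrable_times_f_squared[of _ "(p - 1) * C\<rho> * B powr (p - 2)"])
      show "(\<lambda>x. (p - 1) * on_edge G \<rho> h x * \<bar>on_edge G u h x\<bar> powr (p - 2)) \<in> borel_measurable ?M"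
        using \<rho>' u' by measurable
      show "AE x in ?M. x \<in> {s..t} \<longrightarrow>
          \<bar>(p - 1) * on_edge G \<rho> h x * \<bar>on_edge G u h x\<bar> powr (p - 2)\<bar> \<le> (p - 1) * C\<rho> * B powr (p - 2)"
        using C\<rho>
      proof eventually_elim
        case (elim x)
        show ?case
        proof
          assume "x \<in> {s..t}"
          then have "\<bar>on_edge G u h x\<bar> powr (p - 2) \<le> B powr (p - 2)"
            using B p by (intro powr_mono2) auto
          moreover have "(p - 1) * \<bar>on_edge G \<rho> h x\<bar> \<le> (p - 1) * C\<rho>"
            using elim p by (intro mult_left_mono) auto
          moreover have "0 \<le> C\<rho>" using elim by linarith
          ultimately have "(p - 1) * \<bar>on_edge G \<rho> h x\<bar> * \<bar>on_edge G u h x\<bar> powr (p - 2)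
              \<le> (p - 1) * C\<rho> * B powr (p - 2)"
            using p by (intro mult_mono) auto
          then show "\<bar>(p - 1) * on_edge G \<rho> h x * \<bar>on_edge G u h x\<bar> powr (p - 2)\<bar>
              \<le> (p - 1) * C\<rho> * B powr (p - 2)"
            using p by (simp add: abs_mult)
        qed
      qed
    qed
    show "integrable ?M ?F2"
      by (intro Bochner_Integration.integrable_diff Bochner_Integration.integrable_add f'2 W_int \<rho>_int)
    show "integrable ?M ?F3"
      by (intro Bochner_Integration.integrable_diff f'2 f2)
    show "AE x in ?M. ?F2 x \<le> ?F3 x"
      using \<rho>_nonneg W_le
    proof eventually_elim
      case (elim x)
      show ?case
      proof (cases "x \<in> {s..t}")
        case True
        then have "(on_edge G W h x + lam) * (f x)\<^sup>2 \<le> - d * (f x)\<^sup>2"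
          using elim by (intro mult_right_mono) auto
        moreover have "0 \<le> (p - 1) * on_edge G \<rho> h x * \<bar>on_edge G u h x\<bar> powr (p - 2) * (f x)\<^sup>2"
          using elim p by simp
        ultimately show ?thesis by linarith
      next
        case False
        then show ?thesis using supp[OF False] by simp
      qed
    qed
  qed
  also have "\<dots> = integral {s..t} ?F3"
  proof (rule integral_continuous_supported)
    show "continuous_on UNIV ?F3" by (intro continuous_intros cont cont')
    show "?F3 x = 0" if "x \<notin> {s..t}" for x using supp[OF that] supp'[OF that] by simp
    show "{s..t} \<subseteq> edge_interval G h" using s by (auto simp: half_line_interval[OF h])
  qed (rule I)
  finally show ?thesis .
qed

section \<open>Trains of bumps\<close>

text \<open>With \<open>y = x - a\<close> the integrand is
  \<open>4 y^2 (T-y)^2 (T-2y)^2 - d y^4 (T-y)^4\<close>. The coefficients are Beta integrals: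
  \<open>B(5,5) = 1/630\<close> and \<open>4 (B(3,3) - 4 B(4,4)) = 2/105\<close>.\<close>

lemma bump_energy:
  assumes "0 \<le> T"
  shows "((\<lambda>x. (bump' a (a + T) x)\<^sup>2 - d * (bump a (a + T) x)\<^sup>2) has_integral
    2 * T ^ 7 / 105 - d * T ^ 9 / 630) {a..a + T}"
proof -
  \<comment> \<open>an antiderivative of the polynomial in \<open>y = x - a\<close> that the integrand is on \<open>{a..a + T}\<close>\<close>
  define P where "P y = 4 / 3 * T ^ 4 * y ^ 3 - 6 * T ^ 3 * y ^ 4 + 52 / 5 * T\<^sup>2 * y ^ 5 - 8 * T * y ^ 6
      + 16 / 7 * y ^ 7 - d * (T ^ 4 * y ^ 5 / 5 - 2 * T ^ 3 * y ^ 6 / 3 + 6 * T\<^sup>2 * y ^ 7 / 7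
      - T * y ^ 8 / 2 + y ^ 9 / 9)" for y
  define P' where "P' y = 4 * T ^ 4 * y\<^sup>2 - 24 * T ^ 3 * y ^ 3 + 52 * T\<^sup>2 * y ^ 4 - 48 * T * y ^ 5 + 16 * y ^ 6
      - d * (T ^ 4 * y ^ 4 - 4 * T ^ 3 * y ^ 5 + 6 * T\<^sup>2 * y ^ 6 - 4 * T * y ^ 7 + y ^ 8)" for y
  have P: "(P has_real_derivative P' y) (at y)" for y
    unfolding P_def P'_def by (rule derivative_eq_intros refl | simp add: algebra_simps)+
  have "((\<lambda>x. P' (x - a)) has_integral P (a + T - a) - P (a - a)) {a..a + T}"
  proof (rule fundamental_theorem_of_calculus)
    fix x
    have "((\<lambda>x. P (x - a)) has_real_derivative P' (x - a) * 1) (at x within {a..a + T})"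
      by (rule DERIV_chain2[OF P]) (auto intro!: derivative_eq_intros)
    then show "((\<lambda>x. P (x - a)) has_vector_derivative P' (x - a)) (at x within {a..a + T})"
      by (simp add: has_real_derivative_iff_has_vector_derivative)
  qed (use assms in simp)
  moreover have "P' (x - a) = (bump' a (a + T) x)\<^sup>2 - d * (bump a (a + T) x)\<^sup>2" if "x \<in> {a..a + T}" for x
  proof -
    define y where "y = x - a"
    have "max 0 (x - a) = y" "max 0 (a + T - x) = T - y" using that by (auto simp: y_def)
    moreover have "P' y = (2 * y * (T - y)\<^sup>2 - 2 * y\<^sup>2 * (T - y))\<^sup>2 - d * (y\<^sup>2 * (T - y)\<^sup>2)\<^sup>2"
      unfolding P'_def by algebra
    ultimately show ?thesis unfolding bump_def bump'_def by (simp add: y_def)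
  qed
  ultimately have "((\<lambda>x. (bump' a (a + T) x)\<^sup>2 - d * (bump a (a + T) x)\<^sup>2) has_integral P (a + T - a) - P (a - a)) {a..a + T}"
    by (rule has_integral_eq[rotated])
  moreover have "P (a + T - a) - P (a - a) = 2 * T ^ 7 / 105 - d * T ^ 9 / 630"
    unfolding P_def by (simp add: algebra_simps flip: power_add power_Suc)
  ultimately show ?thesis by simp
qed

text \<open>All cross terms of the expanded square vanish; this makes the energy diagonal on bumps
  with disjoint supports.\<close>

lemma power2_sum_disjoint:
  fixes x :: "'i \<Rightarrow> real"
  assumes "finite A" and "\<And>i j. i \<in> A \<Longrightarrow> j \<in> A \<Longrightarrow> i \<noteq> j \<Longrightarrow> x i * x j = 0"
  shows "(\<Sum>i\<in>A. x i)\<^sup>2 = (\<Sum>i\<in>A. (x i)\<^sup>2)"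
proof -
  have "(\<Sum>i\<in>A. x i)\<^sup>2 = (\<Sum>i\<in>A. \<Sum>j\<in>A. x i * x j)"
    by (simp add: power2_eq_square sum_product)
  also have "\<dots> = (\<Sum>i\<in>A. \<Sum>j\<in>A. if j = i then (x i)\<^sup>2 else 0)"
    using assms(2) by (intro sum.cong refl) (auto simp: power2_eq_square)
  also have "\<dots> = (\<Sum>i\<in>A. (x i)\<^sup>2)"
    using assms(1) by simp
  finally show ?thesis .
qed

lemma sum_fun_apply: "(\<Sum>v\<in>s. g v) q = (\<Sum>v\<in>s. g v q)"
  by (induction s rule: infinite_finite_induct) simp_all

locale bump_train =
  fixes G :: "('v, 'e) metric_graph" and h :: 'e and a T :: real
  assumes wf: "wf_metric_graph G" and h: "h \<in> half_lines G" and a: "0 < a" and T: "0 < T"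
begin

text \<open>Left end of the cell with index \<open>i\<close>. The cells have length \<open>T\<close>
  and are laid end to end; neighbours share an endpoint, where both bumps vanish together with their
  derivatives.\<close>

definition left :: "nat \<Rightarrow> real" where "left i = a + real i * T"

definition cell_bump :: "nat \<Rightarrow> ('v, 'e) gpoint \<Rightarrow> real" where
  "cell_bump i = line_fun h (bump (left i) (left i + T))"

lemma left_less:
  assumes "i < j"
  shows "left i + T \<le> left j"
proof -
  have "left i + T = a + real (Suc i) * T" by (simp add: left_def algebra_simps)
  also have "\<dots> \<le> a + real j * T" using assms T by (intro add_left_mono mult_right_mono) auto
  finally show ?thesis by (simp add: left_def)
qed

lemma cells_disjoint:
  assumes "i \<noteq> j"
  shows "x \<notin> {left i<..<left i + T} \<or> x \<notin> {left j<..<left j + T}"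
proof (cases "i < j")
  case True
  then show ?thesis using left_less[of i j] by auto
next
  case False
  then show ?thesis using assms left_less[of j i] by auto
qed

text \<open>Evaluation at the midpoints of the cells serves as a dual family: it separates the bumps
  and later shows their independence.\<close>

lemma cell_bump_midpoint: "cell_bump i (Inner h (left j + T / 2)) \<noteq> 0 \<longleftrightarrow> i = j"
proof -
  have mid: "left j + T / 2 \<in> {left j<..<left j + T}" using T by auto
  have "0 < left j + T / 2" using a T by (simp add: left_def add_pos_nonneg)
  then have "cell_bump i (Inner h (left j + T / 2)) = bump (left i) (left i + T) (left j + T / 2)"
    by (simp add: cell_bump_def line_fun_def)
  then show ?thesis
    using bump_eq_0_iff[of "left i" "left i + T" "left j + T / 2"] cells_disjoint[of i j "left j + T / 2"] mid
    by metis
qed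

lemma inj_cell_bump: "inj cell_bump"
  by (rule injI) (metis cell_bump_midpoint)

definition train :: "nat set \<Rightarrow> (nat \<Rightarrow> real) \<Rightarrow> real \<Rightarrow> real" where
  "train A c x = (\<Sum>i\<in>A. c i * bump (left i) (left i + T) x)"

definition train' :: "nat set \<Rightarrow> (nat \<Rightarrow> real) \<Rightarrow> real \<Rightarrow> real" where
  "train' A c x = (\<Sum>i\<in>A. c i * bump' (left i) (left i + T) x)"

lemma cell_subset:
  assumes "A \<subseteq> {..<n}" and "i \<in> A"
  shows "{left i..left i + T} \<subseteq> {a..left n}"
proof -
  have "i < n" using assms by blast
  then have "left i + T \<le> left n" by (rule left_less)
  moreover have "a \<le> left i" using T by (simp add: left_def)
  ultimately show ?thesis by auto
qed

lemma half_line_function_train: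
  assumes A: "A \<subseteq> {..<n}"
  shows "half_line_function G h (train A c) (train' A c) a (left n)"
proof
  show "(train A c has_real_derivative train' A c x) (at x)" for x
    unfolding train_def train'_def by (intro DERIV_sum DERIV_cmult bump_has_derivative)
  show "continuous_on UNIV (train' A c)"
    unfolding train'_def by (intro continuous_intros continuous_bump')
  have out: "x \<notin> {left i<..<left i + T}" if "x \<notin> {a..left n}" "i \<in> A" for x i
    using cell_subset[OF A that(2)] that(1) by auto
  show "train A c x = 0" if "x \<notin> {a..left n}" for x
    unfolding train_def
  proof (rule sum.neutral, rule ballI)
    fix i assume "i \<in> A"
    then have "bump (left i) (left i + T) x = 0" using out[OF that] bump_eq_0_iff by blast
    then show "c i * bump (left i) (left i + T) x = 0" by simp
  qed
  show "train' A c x = 0" if "x \<notin> {a..left n}" for x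
    unfolding train'_def
  proof (rule sum.neutral, rule ballI)
    fix i assume "i \<in> A"
    then have "bump' (left i) (left i + T) x = 0" using out[OF that] bump'_eq_0 by blast
    then show "c i * bump' (left i) (left i + T) x = 0" by simp
  qed
qed (rule wf h a)+

text \<open>Different bumps have disjoint supports up to endpoints, so squares of sums are sums of
  squares, and the energy of a single bump is the same for all cells by translation.\<close>

lemma train_energy:
  assumes A: "A \<subseteq> {..<n}"
  shows "((\<lambda>x. (train' A c x)\<^sup>2 - d * (train A c x)\<^sup>2) has_integral
    (\<Sum>i\<in>A. (c i)\<^sup>2 * (2 * T ^ 7 / 105 - d * T ^ 9 / 630))) {a..left n}"
proof -
  have fin: "finite A" using A finite_subset by blast
  let ?q = "\<lambda>i x. (bump' (left i) (left i + T) x)\<^sup>2 - d * (bump (left i) (left i + T) x)\<^sup>2"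
  have eq: "(train' A c x)\<^sup>2 - d * (train A c x)\<^sup>2 = (\<Sum>i\<in>A. (c i)\<^sup>2 * ?q i x)" for x
  proof -
    have prod0: "bump (left i) (left i + T) x * bump (left j) (left j + T) x = 0"
      "bump' (left i) (left i + T) x * bump' (left j) (left j + T) x = 0" if "i \<noteq> j" for i j
      using cells_disjoint[OF that, of x] bump_eq_0_iff bump'_eq_0 mult_eq_0_iff by metis+
    have "(train A c x)\<^sup>2 = (\<Sum>i\<in>A. (c i * bump (left i) (left i + T) x)\<^sup>2)"
      unfolding train_def
    proof (rule power2_sum_disjoint[OF fin])
      fix i j :: nat assume "i \<noteq> j"
      then show "c i * bump (left i) (left i + T) x * (c j * bump (left j) (left j + T) x) = 0"
        using prod0(1)[of i j] by auto
    qed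
    moreover have "(train' A c x)\<^sup>2 = (\<Sum>i\<in>A. (c i * bump' (left i) (left i + T) x)\<^sup>2)"
      unfolding train'_def
    proof (rule power2_sum_disjoint[OF fin])
      fix i j :: nat assume "i \<noteq> j"
      then show "c i * bump' (left i) (left i + T) x * (c j * bump' (left j) (left j + T) x) = 0"
        using prod0(2)[of i j] by auto
    qed
    ultimately show ?thesis
      by (simp add: sum_distrib_left algebra_simps power_mult_distrib flip: sum_subtractf)
  qed
  have "(?q i has_integral (2 * T ^ 7 / 105 - d * T ^ 9 / 630)) {a..left n}" if "i \<in> A" for i
  proof (rule has_integral_on_superset)
    show "(?q i has_integral (2 * T ^ 7 / 105 - d * T ^ 9 / 630)) {left i..left i + T}"
      using T by (intro bump_energy) simp
    show "{left i..left i + T} \<subseteq> {a..left n}" using A that by (rule cell_subset)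
    show "?q i x = 0" if "x \<notin> {left i..left i + T}" for x
    proof -
      have "x \<notin> {left i<..<left i + T}" using that by auto
      then have "bump (left i) (left i + T) x = 0" "bump' (left i) (left i + T) x = 0"
        using bump_eq_0_iff bump'_eq_0 by blast+
      then show ?thesis by simp
    qed
  qed
  then have "((\<lambda>x. \<Sum>i\<in>A. (c i)\<^sup>2 * ?q i x) has_integral
      (\<Sum>i\<in>A. (c i)\<^sup>2 * (2 * T ^ 7 / 105 - d * T ^ 9 / 630))) {a..left n}"
    by (intro has_integral_sum fin has_integral_mult_right)
  then show ?thesis unfolding eq .
qed

section \<open>The span of the bumps, its dimension and the Morse index\<close>

lemma sum_cell_bump: "(\<Sum>i\<in>A. c i * cell_bump i q) = line_fun h (train A c) q"
  by (cases q) (auto simp: cell_bump_def line_fun_def train_def intro!: sum.neutral)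

text \<open>Injectivity of \<open>cell_bump\<close> turns a finite combination of functions into a
  finite combination over indices; the bound \<open>n\<close> confines the support to
  \<open>{a..left n}\<close>.\<close>

lemma span_cell_bumps:
  assumes "\<phi> \<in> fun_vs.span (range cell_bump)"
  obtains A n c where "A \<subseteq> {..<n::nat}" "\<phi> = line_fun h (train A c)"
proof -
  from assms obtain t r where t: "finite t" "t \<subseteq> range cell_bump" and \<phi>: "\<phi> = (\<Sum>v\<in>t. (\<lambda>x. r v * v x))"
    unfolding fun_vs.span_explicit by blast
  from t obtain A where A: "finite A" "t = cell_bump ` A"
    using finite_subset_image[of t cell_bump UNIV] by blast
  have "\<phi> q = line_fun h (train A (\<lambda>i. r (cell_bump i))) q" for q
  proof -
    have "\<phi> q = (\<Sum>v\<in>cell_bump ` A. r v * v q)"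
      using \<phi> A(2) by (simp add: sum_fun_apply)
    also have "\<dots> = (\<Sum>i\<in>A. r (cell_bump i) * cell_bump i q)"
      by (subst sum.reindex) (use inj_cell_bump in \<open>auto intro: inj_on_subset\<close>)
    finally show ?thesis by (simp add: sum_cell_bump)
  qed
  then have "\<phi> = line_fun h (train A (\<lambda>i. r (cell_bump i)))" by blast
  moreover obtain n where "A \<subseteq> {..<n}" using A(1) finite_nat_iff_bounded by blast
  ultimately show ?thesis using that by blast
qed

text \<open>Evaluating a linear relation at the midpoint of cell \<open>j\<close> leaves only the
  term of bump \<open>j\<close>, so its coefficient must be 0.\<close>

lemma independent_cell_bumps: "fun_vs.independent (range cell_bump)"
proof
  assume "fun_vs.dependent (range cell_bump)"
  then obtain t r where t: "finite t" "t \<subseteq> range cell_bump" and zero: "(\<Sum>v\<in>t. (\<lambda>x. r v * v x)) = 0"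
    and nz: "\<exists>v\<in>t. r v \<noteq> 0"
    unfolding fun_vs.dependent_explicit by blast
  from nz t obtain j where j: "cell_bump j \<in> t" "r (cell_bump j) \<noteq> 0" by blast
  let ?q = "Inner h (left j + T / 2) :: ('v, 'e) gpoint"
  have "0 = (\<Sum>v\<in>t. r v * v ?q)"
    using arg_cong[OF zero, of "\<lambda>f. f ?q"] by (simp add: sum_fun_apply)
  also have "\<dots> = (\<Sum>v\<in>t. if v = cell_bump j then r v * v ?q else 0)"
  proof (rule sum.cong[OF refl])
    fix v assume "v \<in> t"
    then obtain i where "v = cell_bump i" using t(2) by blast
    then show "r v * v ?q = (if v = cell_bump j then r v * v ?q else 0)"
      using cell_bump_midpoint[of i j] by (cases "i = j") auto
  qed
  also have "\<dots> = r (cell_bump j) * cell_bump j ?q"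
    using t(1) j(1) by simp
  finally show False using j(2) cell_bump_midpoint[of j j] by simp
qed

text \<open>A finite spanning set would force the independent family of bumps to be finite, although
  it is indexed injectively by the natural numbers.\<close>

lemma fun_edim_cell_bumps: "fun_edim (fun_vs.span (range cell_bump)) = \<infinity>"
proof -
  have False if B: "finite B" "fun_vs.span B = fun_vs.span (range cell_bump)" for B
  proof -
    have "range cell_bump \<subseteq> fun_vs.span B"
      using fun_vs.span_superset[of "range cell_bump"] unfolding B(2) .
    then have "finite (range cell_bump)"
      using fun_vs.independent_span_bound[OF B(1) independent_cell_bumps] by blast
    then show False
      using finite_imageD[OF _ inj_cell_bump] by simp
  qed
  then show ?thesis unfolding fun_edim_def by auto
qed

text \<open>The whole span of the bumps is an admissible subspace in the supremum. The condition
  \<open>12 < d * T^2\<close> says exactly that one bump has negative energy.\<close>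

lemma morse_index_infinite:
  assumes W: "Linf_graph G W" and \<rho>: "Linf_graph G \<rho>" and u: "u \<in> H1_graph G" and p: "2 < p"
    and \<rho>_nonneg: "AE x in edge_measure G h. 0 \<le> on_edge G \<rho> h x"
    and W_le: "AE x in edge_measure G h. a \<le> x \<longrightarrow> on_edge G W h x + lam \<le> - d"
    and d: "12 < d * T\<^sup>2"
  shows "morse_index G p W \<rho> lam u = \<infinity>"
proof -
  let ?X = "fun_vs.span (range cell_bump)"
  \<comment> \<open>Since \<open>2/105 = 12/630\<close>, this is the hypothesis \<open>d\<close>
    multiplied by the positive number \<open>T^7 / 630\<close>.\<close>
  have \<kappa>: "2 * T ^ 7 / 105 - d * T ^ 9 / 630 < 0"
  proof -
    have "T ^ 7 * 12 < T ^ 7 * (d * T\<^sup>2)" using d T by (intro mult_strict_left_mono) simp_all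
    also have "\<dots> = d * T ^ 9" by (simp add: power_add[symmetric] mult.left_commute)
    finally show ?thesis by simp
  qed
  have "morse_form G p W \<rho> lam u \<phi> < 0" if "\<phi> \<in> ?X" "\<phi> \<noteq> 0" for \<phi>
  proof -
    obtain A n c where A: "A \<subseteq> {..<n}" and \<phi>: "\<phi> = line_fun h (train A c)"
      using \<open>\<phi> \<in> ?X\<close> by (rule span_cell_bumps)
    interpret half_line_function G h "train A c" "train' A c" a "left n"
      using A by (rule half_line_function_train)
    have "morse_form G p W \<rho> lam u \<phi> \<le> integral {a..left n} (\<lambda>x. (train' A c x)\<^sup>2 - d * (train A c x)\<^sup>2)"
      unfolding \<phi> by (rule morse_form_line_fun_le[OF W \<rho> u p \<rho>_nonneg W_le])
    also have "\<dots> = (\<Sum>i\<in>A. (c i)\<^sup>2 * (2 * T ^ 7 / 105 - d * T ^ 9 / 630))"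
      using train_energy[OF A] by (rule integral_unique)
    also have "\<dots> < 0"
    proof -
      have "\<exists>i\<in>A. c i \<noteq> 0"
      proof (rule ccontr)
        assume "\<not> (\<exists>i\<in>A. c i \<noteq> 0)"
        then have "train A c x = 0" for x unfolding train_def by (intro sum.neutral) simp
        then have "\<phi> q = 0" for q unfolding \<phi> by (cases q) (simp_all add: line_fun_def)
        then show False using \<open>\<phi> \<noteq> 0\<close> by (auto simp: fun_eq_iff)
      qed
      then have "0 < (\<Sum>i\<in>A. (c i)\<^sup>2)"
        using A finite_subset[OF A] by (auto intro!: sum_pos2)
      then show ?thesis
        using \<kappa> by (simp add: mult_pos_neg flip: sum_distrib_right)
    qed
    finally show ?thesis .
  qed
  moreover have "?X \<subseteq> H1_graph G \<inter> Cc_graph G"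
  proof
    fix \<phi> assume "\<phi> \<in> ?X"
    then obtain A n c where A: "A \<subseteq> {..<n}" and \<phi>: "\<phi> = line_fun h (train A c)"
      by (rule span_cell_bumps)
    interpret half_line_function G h "train A c" "train' A c" a "left n"
      using A by (rule half_line_function_train)
    show "\<phi> \<in> H1_graph G \<inter> Cc_graph G"
      unfolding \<phi> using line_fun_H1 line_fun_Cc by blast
  qed
  ultimately have "fun_edim ?X \<le> morse_index G p W \<rho> lam u"
    unfolding morse_index_def by (intro SUP_upper) (auto simp: fun_vs.subspace_span)
  then show ?thesis by (simp add: fun_edim_cell_bumps)
qed

end

section \<open>From the essential limit superior to an almost everywhere bound, and the
  contradiction\<close>

lemma ess_limsup_less_imp_AE:
  assumes "ess_limsup_at_top f < ereal c"
  obtains R d where "0 \<le> R" "0 < d" "AE x in lebesgue_on {0..}. R \<le> x \<longrightarrow> f x \<le> c - d"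
proof -
  from assms obtain R where R: "0 \<le> R" "esssup (lebesgue_on {R..}) (\<lambda>x. ereal (f x)) < ereal c"
    unfolding ess_limsup_at_top_def INF_less_iff by auto
  \<comment> \<open>A real number strictly in between yields the positive real gap
    \<open>c - r\<close>, even if the essential supremum is minus infinity.\<close>
  obtain r where r: "esssup (lebesgue_on {R..}) (\<lambda>x. ereal (f x)) < ereal r" "ereal r < ereal c"
    using ereal_dense2[OF R(2)] by blast
  have "AE x in lebesgue_on {R..}. ereal (f x) \<le> esssup (lebesgue_on {R..}) (\<lambda>x. ereal (f x))"
    by (rule esssup_AE)
  then have "AE x in lebesgue_on {R..}. f x \<le> r"
  proof eventually_elim
    case (elim x)
    then have "ereal (f x) \<le> ereal r" using r(1) by (meson le_less_trans less_imp_le)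
    then show ?case by simp
  qed
  then have "AE x in lebesgue. x \<in> {R..} \<longrightarrow> f x \<le> r"
    by (simp add: AE_restrict_space_iff)
  then have "AE x in lebesgue. x \<in> {0..} \<longrightarrow> R \<le> x \<longrightarrow> f x \<le> c - (c - r)"
    by eventually_elim simp
  then have "AE x in lebesgue_on {0..}. R \<le> x \<longrightarrow> f x \<le> c - (c - r)"
    by (simp add: AE_restrict_space_iff)
  then show ?thesis using that[of R "c - r"] R(1) r(2) by simp
qed

theorem proposition4p8:
  fixes G :: "('v, 'e) metric_graph"
    and p lam :: real
    and W \<rho> u :: "('v, 'e) gpoint \<Rightarrow> real"
  assumes "graph_class G"
    and "half_lines G \<noteq> {}"
    and "p > 2"
    and "Linf_graph G W"
    and "Linf_graph G \<rho>"
    and "\<not> ae_zero_graph G \<rho>"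
    and "\<exists>a>0. \<forall>e\<in>edges G.
           (AE x in edge_measure G e. on_edge G \<rho> e x \<ge> a) \<or>
           (AE x in edge_measure G e. on_edge G \<rho> e x = 0)"
    and "weak_solution G p W \<rho> lam u"
    and "morse_index G p W \<rho> lam u < \<infinity>"
  shows "ereal lam \<ge> - (INF h\<in>half_lines G. ess_limsup_at_top (on_edge G W h))"
proof (rule ccontr)
  assume "\<not> ?thesis"
  then have "ereal lam < - (INF h\<in>half_lines G. ess_limsup_at_top (on_edge G W h))"
    by simp
  then have "(INF h\<in>half_lines G. ess_limsup_at_top (on_edge G W h)) < - ereal lam"
    by (rule ereal_less_uminus_reorder[THEN iffD1])
  then have "(INF h\<in>half_lines G. ess_limsup_at_top (on_edge G W h)) < ereal (- lam)"
    by simp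
  then obtain h where h: "h \<in> half_lines G" and "ess_limsup_at_top (on_edge G W h) < ereal (- lam)"
    unfolding INF_less_iff by blast
  then obtain R d where R: "0 \<le> R" and d: "0 < d"
    and W_le: "AE x in lebesgue_on {0..}. R \<le> x \<longrightarrow> on_edge G W h x \<le> - lam - d"
    using ess_limsup_less_imp_AE by blast
  \<comment> \<open>This choice gives \<open>d * T^2 = 16\<close>, which exceeds the threshold
    12.\<close>
  define T where "T = 4 / sqrt d"
  \<comment> \<open>Starting at \<open>R + 1\<close> keeps the first cell away from the vertex,
    since \<open>R\<close> may be 0.\<close>
  interpret bump_train G h "R + 1" T
    using assms(1) h R d by unfold_locales (auto simp: graph_class_def T_def)
  have "morse_index G p W \<rho> lam u = \<infinity>"
  proof (rule morse_index_infinite[OF assms(4,5) _ assms(3)])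
    show "u \<in> H1_graph G"
      using assms(8) by (simp add: weak_solution_def)
    \<comment> \<open>Either alternative of the hypothesis on \<open>\<rho>\<close> makes it
      nonnegative almost everywhere on \<open>h\<close>.\<close>
    obtain b where "0 < b" "(AE x in edge_measure G h. on_edge G \<rho> h x \<ge> b) \<or>
        (AE x in edge_measure G h. on_edge G \<rho> h x = 0)"
      using assms(7) half_line_edge[OF h] by blast
    then show "AE x in edge_measure G h. 0 \<le> on_edge G \<rho> h x"
      by (auto elim: eventually_mono)
    show "AE x in edge_measure G h. R + 1 \<le> x \<longrightarrow> on_edge G W h x + lam \<le> - d"
      using W_le unfolding half_line_interval[OF h] by eventually_elim auto
    show "12 < d * T\<^sup>2"
      using d by (simp add: T_def power_divide)
  qed
  then show False using assms(9) by simp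
qed

end
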